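(* Let $n\ge1$ and $1\le k\le n$, and let $\lambda=(k)$ be the row shape of length $k$. Then $\mathbf{S}_{(k)}(n)=\mathbf{H}_k(n)$ in $\mathbf{U}(gl(n))$.
   Context: Virtual method. $gl(m_0|m_1+n)$ ($m_0,m_1$ sufficiently large) is the complex general linear Lie superalgebra with basis $e_{a,b}$, $a,b\in A_0\cup A_1\cup L$, $A_0=\{\alpha_1,\dots,\alpha_{m_0}\}$ (parity $0$), $A_1=\{\beta_1,\dots,\beta_{m_1}\}$ (parity $1$), $L=\{1,\dots,n\}$ (parity $1$), $|e_{a,b}|=|a|+|b|$, and $[e_{a,b},e_{c,d}]=\delta_{bc}e_{a,d}-(-1)^{(|a|+|b|)(|c|+|d|)}\delta_{ad}e_{c,b}$. Symbols in $A_0\cup A_1$ are virtual. $gl(n)$ is the subalgebra spanned by $e_{i,j}$, $i,j\in L$, so $\mathbf{U}(gl(n))\subset\mathbf{U}(gl(m_0|m_1+n))$. A product $e_{a_M,b_M}\cdots e_{a_1,b_1}$ is irregular if there are $i\le M$ and a virtual symbol $\gamma$ with $\#\{j\le i: b_j=\gamma\}>\#\{j<i: a_j=\gamma\}$. Let $\mathbf{Irr}$ be the left ideal of $\mathbf{U}(gl(m_0|m_1+n))$ generated by irregular products. The sum $Virt(m_0+m_1,n)=\mathbf{U}(gl(n))\oplus\mathbf{Irr}$ is direct and is a subalgebra in which $\mathbf{Irr}$ is a two-sided ideal; $\mathfrak p:Virt(m_0+m_1,n)\to\mathbf{U}(gl(n))$ is the projection with kernel $\mathbf{Irr}$ (an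 algebra epimorphism). All monomials to which $\mathfrak p$ is applied here lie in $Virt(m_0+m_1,n)$. For two Young tableaux $S,T$ of the same shape $\lambda$, $e_{S,T}$ is the product of the $e_{s,t}$, $s,t$ being the entries of $S,T$ in the same cell, cells being read row by row from top to bottom and left to right. $C^*_\lambda$ has all entries in row $i$ equal to $\alpha_i$; $D^*_\lambda$ has all entries in column $j$ equal to $\beta_j$. $H(\lambda)$ is the product of the hook lengths of $\lambda$. For $\lambda_1\le n$, $$\mathbf{S}_\lambda(n)=\frac1{H(\lambda)}\sum_S\mathfrak p\big(e_{S,C^*_\lambda}\cdot e_{C^*_\lambda,D^*_\lambda}\cdot e_{D^*_\lambda,C^*_\lambda}\cdot e_{C^*_\lambda,S}\big),$$ over all tableaux $S$ of shape $\lambda$ on $\{1,\dots,n\}$ with strictly increasing rows. For $1\le k\le n$ and any $\alpha\in A_0$, $$\mathbf{H}_k(n)=\sum_{1\le i_1<\cdots<i_k\le n}\mathfrak p\big(e_{i_k,\alpha}\cdots e_{i_2,\alpha}e_{i_1,\alpha}\,e_{\alpha,i_1}e_{\alpha,i_2}\cdots e_{\alpha,i_k}\big).$$ *)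

theory Defs
  imports Complex_Main "HOL-Library.Poly_Mapping" "HOL-Algebra.QuotRing"
begin

section \<open>Left ideals and ordered products in a ring\<close>

definition left_ideal :: "'a set \<Rightarrow> ('a, 'b) ring_scheme \<Rightarrow> bool" where
  "left_ideal J R \<longleftrightarrow>
     additive_subgroup J R \<and> (\<forall>x \<in> carrier R. \<forall>a \<in> J. x \<otimes>\<^bsub>R\<^esub> a \<in> J)"

definition gen_left_ideal :: "('a, 'b) ring_scheme \<Rightarrow> 'a set \<Rightarrow> 'a set" where
  "gen_left_ideal R S = \<Inter>{J. left_ideal J R \<and> S \<subseteq> J}"

definition list_prod :: "('a, 'b) ring_scheme \<Rightarrow> 'a list \<Rightarrow> 'a" where
  "list_prod R xs = foldr (\<lambda>x y. x \<otimes>\<^bsub>R\<^esub> y) xs \<one>\<^bsub>R\<^esub>"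

section \<open>Free associative algebras\<close>

text \<open>Words under concatenation. The wrapper avoids putting an arithmetic structure on the
  type of lists itself.\<close>

datatype 'g fword = Word (letters: "'g list")

instantiation fword :: (type) monoid_add
begin

definition zero_fword :: "'a fword" where
  "0 = Word []"

definition plus_fword :: "'a fword \<Rightarrow> 'a fword \<Rightarrow> 'a fword" where
  "v + w = Word (letters v @ letters w)"

instance
  by standard (simp_all add: zero_fword_def plus_fword_def)

end

lemma letters_zero [simp]: "letters 0 = []"
  by (simp add: zero_fword_def)

lemma letters_plus [simp]: "letters (v + w) = letters v @ letters w"
  by (simp add: plus_fword_def)

text \<open>The multiplication of \<^typ>\<open>'g fword \<Rightarrow>\<^sub>0 complex\<close> is the convolution product, so this
  is the free complex algebra on the letters; \<open>free_alg X\<close> is its subalgebra on \<open>X\<close>.\<close>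

type_synonym 'g free = "'g fword \<Rightarrow>\<^sub>0 complex"

definition free_alg :: "'g set \<Rightarrow> 'g free ring" where
  "free_alg X =
     \<lparr>carrier = {f. \<forall>w \<in> Poly_Mapping.keys f. set (letters w) \<subseteq> X},
      mult = (*), one = 1, zero = 0, add = (+)\<rparr>"

definition free_const :: "complex \<Rightarrow> 'g free" where
  "free_const c = Poly_Mapping.single 0 c"

lemma ring_free_alg: "ring (free_alg (X :: 'g set))"
proof (intro ringI abelian_groupI monoidI)
  fix f :: "'g free" assume f: "f \<in> carrier (free_alg X)"
  have "- f \<in> carrier (free_alg X)"
    using f by (simp add: free_alg_def)
  moreover have "- f \<oplus>\<^bsub>free_alg X\<^esub> f = \<zero>\<^bsub>free_alg X\<^esub>"
    by (simp add: free_alg_def)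
  ultimately show "\<exists>g \<in> carrier (free_alg X). g \<oplus>\<^bsub>free_alg X\<^esub> f = \<zero>\<^bsub>free_alg X\<^esub>"
    by blast
next
  fix f g :: "'g free"
  assume fg: "f \<in> carrier (free_alg X)" "g \<in> carrier (free_alg X)"
  show "f \<oplus>\<^bsub>free_alg X\<^esub> g \<in> carrier (free_alg X)"
    using fg Poly_Mapping.keys_add[of f g] by (fastforce simp: free_alg_def)
  show "f \<otimes>\<^bsub>free_alg X\<^esub> g \<in> carrier (free_alg X)"
    using fg keys_mult[of f g] by (fastforce simp: free_alg_def)
qed (auto simp: free_alg_def algebra_simps)

section \<open>Lie superalgebras with a homogeneous basis and their enveloping algebras\<close>

text \<open>A Lie superalgebra given by a homogeneous basis, the parities (\<open>0\<close> or \<open>1\<close>) of the basis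
  elements and their brackets. Its elements are the \<^typ>\<open>'g \<Rightarrow>\<^sub>0 complex\<close> supported in the
  basis, and the bracket of elements is the bilinear extension \<open>lbracket\<close>.\<close>

record 'g lie_super =
  basis :: "'g set"
  parity :: "'g \<Rightarrow> nat"
  bracket :: "'g \<Rightarrow> 'g \<Rightarrow> ('g \<Rightarrow>\<^sub>0 complex)"

definition lbracket ::
    "'g lie_super \<Rightarrow> ('g \<Rightarrow>\<^sub>0 complex) \<Rightarrow> ('g \<Rightarrow>\<^sub>0 complex) \<Rightarrow> ('g \<Rightarrow>\<^sub>0 complex)" where
  "lbracket \<gg> x y = (\<Sum>s \<in> Poly_Mapping.keys x. \<Sum>t \<in> Poly_Mapping.keys y.
     Poly_Mapping.map (\<lambda>c. Poly_Mapping.lookup x s * Poly_Mapping.lookup y t * c)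
       (bracket \<gg> s t))"

definition homogeneous :: "'g lie_super \<Rightarrow> nat \<Rightarrow> ('g \<Rightarrow>\<^sub>0 complex) set" where
  "homogeneous \<gg> p = {x. Poly_Mapping.keys x \<subseteq> {s \<in> basis \<gg>. parity \<gg> s = p}}"

text \<open>The tensor algebra of \<open>\<gg>\<close> is the free algebra on its basis; \<open>tensor1\<close> is the inclusion
  of \<open>\<gg>\<close> in degree one.\<close>

definition tensor1 :: "('g \<Rightarrow>\<^sub>0 complex) \<Rightarrow> 'g free" where
  "tensor1 x =
     (\<Sum>s \<in> Poly_Mapping.keys x. Poly_Mapping.single (Word [s]) (Poly_Mapping.lookup x s))"

definition env_relations :: "'g lie_super \<Rightarrow> 'g free set" where
  "env_relations \<gg> =
     {tensor1 x * tensor1 y - (-1) ^ (p * q) * (tensor1 y * tensor1 x) - tensor1 (lbracket \<gg> x y)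
      | x y p q. p \<in> {0, 1} \<and> q \<in> {0, 1} \<and> x \<in> homogeneous \<gg> p \<and> y \<in> homogeneous \<gg> q}"

definition env_ideal :: "'g lie_super \<Rightarrow> 'g free set" where
  "env_ideal \<gg> = genideal (free_alg (basis \<gg>)) (env_relations \<gg>)"

definition env :: "'g lie_super \<Rightarrow> 'g free set ring" where
  "env \<gg> = free_alg (basis \<gg>) Quot env_ideal \<gg>"

definition env_class :: "'g lie_super \<Rightarrow> 'g free \<Rightarrow> 'g free set" where
  "env_class \<gg> f = env_ideal \<gg> +>\<^bsub>free_alg (basis \<gg>)\<^esub> f"

definition env_gen :: "'g lie_super \<Rightarrow> 'g \<Rightarrow> 'g free set" where
  "env_gen \<gg> s = env_class \<gg> (Poly_Mapping.single (Word [s]) 1)"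

definition env_scale :: "'g lie_super \<Rightarrow> complex \<Rightarrow> 'g free set \<Rightarrow> 'g free set" where
  "env_scale \<gg> c u = env_class \<gg> (free_const c) \<otimes>\<^bsub>env \<gg>\<^esub> u"

section \<open>The general linear Lie superalgebra\<close>

text \<open>The symbols \<open>\<alpha>\<^sub>i\<close>, \<open>\<beta>\<^sub>j\<close> and \<open>i \<in> L\<close>, all numbered from \<open>1\<close>.\<close>

datatype sym = Alpha nat | Beta nat | Low nat

definition A0 :: "nat \<Rightarrow> sym set" where "A0 m0 = Alpha ` {1..m0}"
definition A1 :: "nat \<Rightarrow> sym set" where "A1 m1 = Beta ` {1..m1}"
definition L :: "nat \<Rightarrow> sym set" where "L n = Low ` {1..n}"

fun sym_parity :: "sym \<Rightarrow> nat" where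
  "sym_parity (Alpha i) = 0"
| "sym_parity (Beta i) = 1"
| "sym_parity (Low i) = 1"

text \<open>The basis element \<open>e\<^bsub>a,b\<^esub>\<close> is represented by the pair \<open>(a, b)\<close>.\<close>

definition elem_parity :: "sym \<times> sym \<Rightarrow> nat" where
  "elem_parity = (\<lambda>(a, b). (sym_parity a + sym_parity b) mod 2)"

definition elem_bracket :: "sym \<times> sym \<Rightarrow> sym \<times> sym \<Rightarrow> (sym \<times> sym \<Rightarrow>\<^sub>0 complex)" where
  "elem_bracket = (\<lambda>(a, b) (c, d).
     Poly_Mapping.single (a, d) (of_bool (b = c)) -
     Poly_Mapping.single (c, b)
       ((-1) ^ (elem_parity (a, b) * elem_parity (c, d)) * of_bool (a = d)))"

definition gl :: "nat \<Rightarrow> nat \<Rightarrow> nat \<Rightarrow> (sym \<times> sym) lie_super" where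
  "gl m0 m1 n =
     \<lparr>basis = (A0 m0 \<union> A1 m1 \<union> L n) \<times> (A0 m0 \<union> A1 m1 \<union> L n),
      parity = elem_parity, bracket = elem_bracket\<rparr>"

abbreviation U :: "nat \<Rightarrow> nat \<Rightarrow> nat \<Rightarrow> (sym \<times> sym) free set ring" where
  "U m0 m1 n \<equiv> env (gl m0 m1 n)"

lemma keys_tensor1: "Poly_Mapping.keys (tensor1 x) \<subseteq> (\<lambda>s. Word [s]) ` Poly_Mapping.keys x"
  unfolding tensor1_def by (rule order.trans[OF keys_sum]) auto

lemma tensor1_carrier: "Poly_Mapping.keys x \<subseteq> X \<Longrightarrow> tensor1 x \<in> carrier (free_alg X)"
  using keys_tensor1[of x] by (fastforce simp: free_alg_def)

lemma elem_bracket_in_gl: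
  assumes "s \<in> basis (gl m0 m1 n)" "t \<in> basis (gl m0 m1 n)"
  shows "Poly_Mapping.keys (elem_bracket s t) \<subseteq> basis (gl m0 m1 n)"
proof -
  obtain a b c d where st: "s = (a, b)" "t = (c, d)"
    by (metis surj_pair)
  have "Poly_Mapping.keys (elem_bracket s t) \<subseteq> {(a, d), (c, b)}"
    unfolding elem_bracket_def st prod.case
    by (rule order.trans[OF keys_diff]) simp
  also have "\<dots> \<subseteq> basis (gl m0 m1 n)"
    using assms unfolding st gl_def by simp
  finally show ?thesis .
qed

lemma keys_lbracket_gl:
  assumes "Poly_Mapping.keys x \<subseteq> basis (gl m0 m1 n)" "Poly_Mapping.keys y \<subseteq> basis (gl m0 m1 n)"
  shows "Poly_Mapping.keys (lbracket (gl m0 m1 n) x y) \<subseteq> basis (gl m0 m1 n)"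
proof -
  have map: "Poly_Mapping.keys (Poly_Mapping.map f z) \<subseteq> Poly_Mapping.keys z"
    for f and z :: "sym \<times> sym \<Rightarrow>\<^sub>0 complex"
    by (auto simp: in_keys_iff map.rep_eq when_def)
  have br: "bracket (gl m0 m1 n) = elem_bracket"
    by (simp add: gl_def)
  show ?thesis
    unfolding lbracket_def br
  proof (intro order.trans[OF keys_sum] UN_least)
    fix s t assume "s \<in> Poly_Mapping.keys x" "t \<in> Poly_Mapping.keys y"
    with assms have "Poly_Mapping.keys (elem_bracket s t) \<subseteq> basis (gl m0 m1 n)"
      by (intro elem_bracket_in_gl) blast+
    with map show "Poly_Mapping.keys (Poly_Mapping.map
        (\<lambda>c. Poly_Mapping.lookup x s * Poly_Mapping.lookup y t * c) (elem_bracket s t))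
      \<subseteq> basis (gl m0 m1 n)"
      by (rule order.trans)
  qed
qed

lemma env_relations_gl: "env_relations (gl m0 m1 n) \<subseteq> carrier (free_alg (basis (gl m0 m1 n)))"
proof
  define g where "g = gl m0 m1 n"
  define R where "R = free_alg (basis g)"
  interpret R: ring R
    unfolding R_def by (rule ring_free_alg)
  have plus: "a + b \<in> carrier R" if "a \<in> carrier R" "b \<in> carrier R" for a b
    using R.a_closed[OF that] by (simp add: R_def free_alg_def)
  have times: "a * b \<in> carrier R" if "a \<in> carrier R" "b \<in> carrier R" for a b
    using R.m_closed[OF that] by (simp add: R_def free_alg_def)
  have uminus: "- a \<in> carrier R" if "a \<in> carrier R" for a
    using that by (simp add: R_def free_alg_def)
  have minus: "a - b \<in> carrier R" if "a \<in> carrier R" "b \<in> carrier R" for a b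
    using plus[OF that(1) uminus[OF that(2)]] by simp
  have sign: "(-1) ^ r * a \<in> carrier R" if "a \<in> carrier R" for r :: nat and a
    using that uminus by (cases "even r") simp_all
  fix f assume "f \<in> env_relations (gl m0 m1 n)"
  then obtain x y p q where f: "f = tensor1 x * tensor1 y -
        (-1) ^ (p * q) * (tensor1 y * tensor1 x) - tensor1 (lbracket g x y)"
      and xy: "x \<in> homogeneous g p" "y \<in> homogeneous g q"
    unfolding env_relations_def g_def by blast
  have keys: "Poly_Mapping.keys x \<subseteq> basis g" "Poly_Mapping.keys y \<subseteq> basis g"
    using xy by (auto simp: homogeneous_def)
  have "Poly_Mapping.keys (lbracket g x y) \<subseteq> basis g"
    using keys unfolding g_def by (rule keys_lbracket_gl)
  with keys have t: "tensor1 x \<in> carrier R" "tensor1 y \<in> carrier R"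
      "tensor1 (lbracket g x y) \<in> carrier R"
    unfolding R_def by (blast intro: tensor1_carrier)+
  have "f \<in> carrier R"
    unfolding f by (intro minus times sign t)
  then show "f \<in> carrier (free_alg (basis (gl m0 m1 n)))"
    by (simp add: R_def g_def)
qed

lemma ring_U: "ring (U m0 m1 n)"
  unfolding env_def env_ideal_def
  by (intro ideal.quotient_is_ring ring.genideal_ideal ring_free_alg env_relations_gl)

text \<open>\<open>U(gl(n))\<close> inside \<open>U(gl(m\<^sub>0|m\<^sub>1+n))\<close>: the subalgebra generated by the \<open>e\<^bsub>i,j\<^esub>\<close> with
  \<open>i, j \<in> L\<close>, that is, the classes of the noncommutative polynomials in these generators.\<close>

definition Ugl :: "nat \<Rightarrow> nat \<Rightarrow> nat \<Rightarrow> (sym \<times> sym) free set set" where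
  "Ugl m0 m1 n = env_class (gl m0 m1 n) ` carrier (free_alg (L n \<times> L n))"

definition e_prod :: "nat \<Rightarrow> nat \<Rightarrow> nat \<Rightarrow> (sym \<times> sym) list \<Rightarrow> (sym \<times> sym) free set" where
  "e_prod m0 m1 n w = list_prod (U m0 m1 n) (map (env_gen (gl m0 m1 n)) w)"

section \<open>The virtual method\<close>

text \<open>The factors of \<open>e\<^bsub>a_M,b_M\<^esub> \<cdots> e\<^bsub>a_1,b_1\<^esub>\<close> are numbered from the right, so the \<open>j\<close>-th one
  is \<open>rev w ! (j - 1)\<close>.\<close>

definition irregular :: "nat \<Rightarrow> nat \<Rightarrow> (sym \<times> sym) list \<Rightarrow> bool" where
  "irregular m0 m1 w \<longleftrightarrow>
     (\<exists>i \<in> {1..length w}. \<exists>\<gamma> \<in> A0 m0 \<union> A1 m1.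
        card {j \<in> {1..i}. snd (rev w ! (j - 1)) = \<gamma>} >
        card {j \<in> {1..<i}. fst (rev w ! (j - 1)) = \<gamma>})"

definition Irr :: "nat \<Rightarrow> nat \<Rightarrow> nat \<Rightarrow> (sym \<times> sym) free set set" where
  "Irr m0 m1 n = gen_left_ideal (U m0 m1 n)
     {e_prod m0 m1 n w | w. set w \<subseteq> basis (gl m0 m1 n) \<and> irregular m0 m1 w}"

definition Virt :: "nat \<Rightarrow> nat \<Rightarrow> nat \<Rightarrow> (sym \<times> sym) free set set" where
  "Virt m0 m1 n = Ugl m0 m1 n <+>\<^bsub>U m0 m1 n\<^esub> Irr m0 m1 n"

definition virt_proj ::
    "nat \<Rightarrow> nat \<Rightarrow> nat \<Rightarrow> (sym \<times> sym) free set \<Rightarrow> (sym \<times> sym) free set" where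
  "virt_proj m0 m1 n = (\<lambda>x \<in> Virt m0 m1 n.
     THE u. u \<in> Ugl m0 m1 n \<and> (\<exists>r \<in> Irr m0 m1 n. x = u \<oplus>\<^bsub>U m0 m1 n\<^esub> r))"

section \<open>Shapes and tableaux\<close>

text \<open>A shape is the list of its row lengths and a tableau is the list of its rows.\<close>

definition cells :: "nat list \<Rightarrow> (nat \<times> nat) set" where
  "cells \<mu> = {(i, j). i < length \<mu> \<and> j < \<mu> ! i}"

definition hook_length :: "nat list \<Rightarrow> nat \<times> nat \<Rightarrow> nat" where
  "hook_length \<mu> = (\<lambda>(i, j).
     card {(i', j') \<in> cells \<mu>. (i' = i \<and> j \<le> j') \<or> (i \<le> i' \<and> j' = j)})"

definition hook_product :: "nat list \<Rightarrow> nat" where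
  "hook_product \<mu> = (\<Prod>c \<in> cells \<mu>. hook_length \<mu> c)"

definition C_star :: "nat list \<Rightarrow> sym list list" where
  "C_star \<mu> = map (\<lambda>i. replicate (\<mu> ! i) (Alpha (i + 1))) [0..<length \<mu>]"

definition D_star :: "nat list \<Rightarrow> sym list list" where
  "D_star \<mu> = map (\<lambda>r. map Beta [1..<r + 1]) \<mu>"

definition row_strict_tableaux :: "nat list \<Rightarrow> nat \<Rightarrow> nat list list set" where
  "row_strict_tableaux \<mu> n =
     {S. map length S = \<mu> \<and> (\<forall>r \<in> set S. sorted_wrt (<) r \<and> set r \<subseteq> {1..n})}"

definition low_tableau :: "nat list list \<Rightarrow> sym list list" where
  "low_tableau S = map (map Low) S"

definition e_tab ::
    "nat \<Rightarrow> nat \<Rightarrow> nat \<Rightarrow> sym list list \<Rightarrow> sym list list \<Rightarrow> (sym \<times> sym) free set" where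
  "e_tab m0 m1 n S T = e_prod m0 m1 n (zip (concat S) (concat T))"

section \<open>The central elements\<close>

definition S_central :: "nat \<Rightarrow> nat \<Rightarrow> nat \<Rightarrow> nat list \<Rightarrow> (sym \<times> sym) free set" where
  "S_central m0 m1 n \<mu> =
     env_scale (gl m0 m1 n) (1 / of_nat (hook_product \<mu>))
       (\<Oplus>\<^bsub>U m0 m1 n\<^esub>S \<in> row_strict_tableaux \<mu> n.
          virt_proj m0 m1 n
            (list_prod (U m0 m1 n)
              [e_tab m0 m1 n (low_tableau S) (C_star \<mu>),
               e_tab m0 m1 n (C_star \<mu>) (D_star \<mu>),
               e_tab m0 m1 n (D_star \<mu>) (C_star \<mu>),
               e_tab m0 m1 n (C_star \<mu>) (low_tableau S)]))"

text \<open>The index \<open>is\<close> below is the list \<open>[i\<^sub>1, \<dots>, i\<^sub>k]\<close>.\<close>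

definition H_central :: "nat \<Rightarrow> nat \<Rightarrow> nat \<Rightarrow> nat \<Rightarrow> sym \<Rightarrow> (sym \<times> sym) free set" where
  "H_central m0 m1 n k \<alpha> =
     (\<Oplus>\<^bsub>U m0 m1 n\<^esub>is \<in> {is. length is = k \<and> sorted_wrt (<) is \<and> set is \<subseteq> {1..n}}.
        virt_proj m0 m1 n
          (e_prod m0 m1 n
            (map (\<lambda>i. (Low i, \<alpha>)) (rev is) @ map (\<lambda>i. (\<alpha>, Low i)) is)))"

end

theory Submission
  imports Defs "HOL-Library.Function_Algebras"
begin

text \<open>Let \<open>M\<close> be the product of the \<open>e\<^bsub>\<alpha>,i\<^esub>\<close> for \<open>i\<close> in a row, put \<open>a\<^sub>i = e\<^bsub>\<alpha>,\<beta>_i\<^esub>\<close> and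
  \<open>b\<^sub>i = e\<^bsub>\<beta>_i,\<alpha>\<^esub>\<close>. Since \<open>[a\<^sub>i, b\<^sub>i] = e\<^bsub>\<alpha>,\<alpha>\<^esub> + e\<^bsub>\<beta>_i,\<beta>_i\<^esub>\<close>, and modulo \<open>Irr\<close> the element
  \<open>e\<^bsub>\<alpha>,\<alpha>\<^esub>\<close> acts on \<open>b\<^sub>m \<cdots> b\<^sub>1 M\<close> by \<open>k - m\<close> while \<open>e\<^bsub>\<beta>_i,\<beta>_i\<^esub>\<close> for \<open>i > m\<close> kills it, one gets
  \<open>a\<^sub>1 \<cdots> a\<^sub>k b\<^sub>k \<cdots> b\<^sub>1 M = k! M\<close> modulo \<open>Irr\<close>. The factor \<open>k!\<close> cancels \<open>H(\<lambda>)\<close>, and the two signs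
  from reversing the \<open>b\<^sub>i\<close> and the \<open>e\<^bsub>i,\<alpha>\<^esub>\<close> cancel each other. Commuting the \<open>e\<^bsub>i,\<alpha>\<^esub>\<close> to the
  right shows that the remaining monomial is congruent to an element of \<open>U(gl(n))\<close> that does not
  depend on \<open>\<alpha>\<close>.

  That the projection is well defined, i.e. that \<open>U(gl(n))\<close> meets \<open>Irr\<close> only in \<open>0\<close>, does not need
  the Poincare-Birkhoff-Witt theorem: \<open>gl(m\<^sub>0|m\<^sub>1+n)\<close> acts on the supersymmetric functions of the modes
  \<open>(\<gamma>, j)\<close>, \<open>\<gamma>\<close> virtual, \<open>j \<in> L\<close>, with values in its enveloping algebra, where \<open>e\<^bsub>\<gamma>,j\<^esub>\<close> creates a mode,
  \<open>e\<^bsub>i,j\<^esub>\<close> is left multiplication corrected by a substitution of modes, and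
  \<open>e\<^bsub>a,\<gamma>\<^esub> = \<Sum>\<^sub>j e\<^bsub>a,j\<^esub> \<partial>\<^bsub>\<gamma>,j\<^esub>\<close>. Irregular products annihilate the vacuum by weight, whereas an
  element \<open>u\<close> of \<open>U(gl(n))\<close> sends the vacuum to a function with value \<open>u\<close> at the empty word.\<close>

section \<open>Preliminaries on the free algebra\<close>

lemma free_const_commute: "free_const c * f = f * free_const c"
proof (induction f rule: update_induct)
  case (update f a b)
  have "Poly_Mapping.update a b f = f + Poly_Mapping.single a b"
    using update(1)
    by (intro poly_mapping_eqI) (auto simp: lookup_update lookup_add lookup_single when_def in_keys_iff)
  then show ?case
    using update(3) by (simp add: algebra_simps free_const_def mult_single)
qed simp

lemma free_const_mult: "free_const a * free_const b = free_const (a * b)"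
  by (simp add: free_const_def mult_single)

lemma free_const_mult_left: "free_const a * (free_const b * f) = free_const (a * b) * f"
  by (simp add: free_const_mult flip: mult.assoc)

lemma free_const_add: "free_const a + free_const b = free_const (a + b)"
  by (simp add: free_const_def single_add)

lemma free_const_1 [simp]: "free_const 1 = 1"
  by (simp add: free_const_def)

lemma free_const_0 [simp]: "free_const 0 = 0"
  by (simp add: free_const_def)

lemma free_const_minus: "free_const (- a) = - free_const a"
  by (simp add: free_const_def single_uminus)

lemma free_const_sign: "free_const ((- 1) ^ k) = (- 1) ^ k"
  by (cases "even k") (simp_all add: free_const_minus)

lemma free_const_of_nat: "free_const (of_nat k) = of_nat k"
  by (simp add: free_const_def)

definition letter :: "'g \<Rightarrow> 'g free" where
  "letter s = Poly_Mapping.single (Word [s]) 1"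

lemma single_Nil: "Poly_Mapping.single (Word []) c = free_const c"
  by (simp add: free_const_def zero_fword_def)

lemma single_Cons: "Poly_Mapping.single (Word (s # w)) c = letter s * Poly_Mapping.single (Word w) c"
  by (simp add: letter_def mult_single plus_fword_def)

lemma sum_single: "(\<Sum>v \<in> Poly_Mapping.keys f. Poly_Mapping.single v (Poly_Mapping.lookup f v)) = f"
  by (intro poly_mapping_eqI)
    (auto simp: lookup_sum lookup_single when_def in_keys_iff)

section \<open>The Fock space\<close>

type_synonym mode = "sym \<times> nat"
text \<open>Values are taken in the free algebra instead of its quotient, so that they are handled
  by type class operations. Identities of the enveloping algebra therefore hold for values only
  modulo \<open>env_ideal\<close>.\<close>

type_synonym fock = "mode list \<Rightarrow> (sym \<times> sym) free"

definition scal :: "complex \<Rightarrow> fock \<Rightarrow> fock" where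
  "scal c f = (\<lambda>w. free_const c * f w)"

interpretation fock: vector_space scal
  by standard
    (auto simp: scal_def fun_eq_iff distrib_left distrib_right free_const_add[symmetric]
      free_const_mult[symmetric] mult.assoc)

lemma scal_apply [simp]: "scal c f w = free_const c * f w"
  by (simp add: scal_def)

abbreviation lin :: "(fock \<Rightarrow> fock) \<Rightarrow> bool" where
  "lin \<equiv> module_hom scal scal"

lemma linI:
  assumes "\<And>f g. P (f + g) = P f + P g" "\<And>c f. P (scal c f) = scal c (P f)"
  shows "lin P"
  using assms by (simp add: module_hom_iff fock.module_axioms)

text \<open>Here 1 is the parity of the second symbol, which lies in L. The sum is not reduced
  modulo 2 because it occurs only in exponents of -1. Modes of \<open>Alpha\<close> anticommute
  among themselves, modes of \<open>Beta\<close> commute with all modes.\<close>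

definition mode_parity :: "mode \<Rightarrow> nat" where
  "mode_parity p = sym_parity (fst p) + 1"

definition ann :: "mode \<Rightarrow> fock \<Rightarrow> fock" where
  "ann p f = (\<lambda>w. f (p # w))"

text \<open>Creation is a signed shuffle product, so it satisfies the canonical (anti)commutation
  relations with annihilation on all functions; only the commutation of two annihilations needs
  supersymmetry.\<close>

fun cre :: "mode \<Rightarrow> fock \<Rightarrow> fock" where
  "cre p f [] = 0"
| "cre p f (q # w) = free_const (of_bool (p = q)) * f w +
     free_const ((-1) ^ (mode_parity p * mode_parity q)) * cre p (ann q f) w"

text \<open>Dual form of the derivation that sends the mode \<open>(c, i)\<close> to
  \<open>(c, k)\<close> for every \<open>c\<close>: a word is read by replacing the index
  \<open>k\<close> by \<open>i\<close> at one position at a time. No sign occurs, because the parity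
  of a mode depends on \<open>c\<close> only.\<close>

fun subst :: "nat \<Rightarrow> nat \<Rightarrow> fock \<Rightarrow> fock" where
  "subst i k f [] = 0"
| "subst i k f ((c, j) # w) =
     free_const (of_bool (j = k)) * f ((c, i) # w) + subst i k (ann (c, j) f) w"

lemma ann_cre: "ann q (cre p f) =
    scal (of_bool (p = q)) f + scal ((-1) ^ (mode_parity p * mode_parity q)) (cre p (ann q f))"
  by (simp add: fun_eq_iff ann_def)

lemma ann_subst: "ann (c, j) (subst i k f) =
    scal (of_bool (j = k)) (ann (c, i) f) + subst i k (ann (c, j) f)"
  by (simp add: fun_eq_iff ann_def)

lemma ann_add [simp]: "ann p (f + g) = ann p f + ann p g"
  by (simp add: fun_eq_iff ann_def)

lemma ann_scal [simp]: "ann p (scal c f) = scal c (ann p f)"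
  by (simp add: fun_eq_iff ann_def)

lemma lin_ann: "lin (ann p)"
  by (rule linI) simp_all

lemma ann_minus [simp]: "ann p (f - g) = ann p f - ann p g"
  by (rule module_hom.diff[OF lin_ann])

lemma free_const_left_commute: "free_const c * (f * g) = f * (free_const c * g)"
  by (metis free_const_commute mult.assoc)

lemma lin_cre: "lin (cre p)"
proof (rule linI; rule ext)
  fix f g :: fock and w c
  show "cre p (f + g) w = (cre p f + cre p g) w"
    by (induction w arbitrary: f g) (simp_all add: algebra_simps)
  show "cre p (scal c f) w = scal c (cre p f) w"
  proof (induction w arbitrary: f)
    case (Cons q w)
    show ?case
      by (simp only: cre.simps ann_scal Cons)
        (simp only: scal_apply cre.simps subst.simps distrib_left free_const_left_commute[of c])
  qed simp
qed

lemma lin_subst: "lin (subst i k)"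
proof (rule linI; rule ext)
  fix f g :: fock and w c
  show "subst i k (f + g) w = (subst i k f + subst i k g) w"
    by (induction w arbitrary: f g) (auto simp: algebra_simps)
  show "subst i k (scal c f) w = scal c (subst i k f) w"
  proof (induction w arbitrary: f)
    case (Cons q w)
    show ?case
      by (cases q, simp only: subst.simps ann_scal Cons)
        (simp only: scal_apply cre.simps subst.simps distrib_left free_const_left_commute[of c])
  qed simp
qed

lemmas lin_simps = module_hom.add module_hom.diff module_hom.scale module_hom.neg

text \<open>Induction on the word, with \<open>f\<close> arbitrary because reading the mode
  \<open>r\<close> turns \<open>f\<close> into \<open>ann r f\<close>. Exchanging \<open>p\<close>
  and \<open>q\<close> interchanges the two contraction terms of \<open>1\<close>, and the remaining
  term is the induction hypothesis.\<close>

lemma cre_cre: "cre p (cre q f) = scal ((-1) ^ (mode_parity p * mode_parity q)) (cre q (cre p f))"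
proof (rule ext)
  fix w show "cre p (cre q f) w = scal ((-1) ^ (mode_parity p * mode_parity q)) (cre q (cre p f)) w"
  proof (induction w arbitrary: f)
    case (Cons r w)
    define s where "s p q = (-1 :: complex) ^ (mode_parity p * mode_parity q)" for p q
    have s: "s p q = s q p" "s p q * s p q = 1" for p q
      unfolding s_def by (simp_all add: mult.commute flip: power_add)
    have IH: "cre p (cre q g) w = free_const (s p q) * cre q (cre p g) w" for g
      using Cons by (simp add: s_def)
    have 1: "cre p (cre q f) (r # w) = free_const (of_bool (p = r)) * cre q f w
        + free_const (s p r) * (free_const (of_bool (q = r)) * cre p f w
        + free_const (s q r) * cre p (cre q (ann r f)) w)" for p q
      by (simp add: ann_cre lin_simps[OF lin_cre] s_def)
    show ?case
      unfolding scal_apply 1 IH s_def[symmetric]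
      by (auto simp: distrib_left free_const_mult_left s(2) s(1)[of r q] s(1)[of r p] ac_simps)
  qed simp
qed

text \<open>The derivation property. Its extra term matches the bracket of e_{c,i} with e_{i,k},
  which is e_{c,k}.\<close>

lemma subst_cre: "subst i k (cre (c, j) f) =
    cre (c, j) (subst i k f) + scal (of_bool (i = j)) (cre (c, k) f)"
proof (rule ext)
  fix w show "subst i k (cre (c, j) f) w =
    (cre (c, j) (subst i k f) + scal (of_bool (i = j)) (cre (c, k) f)) w"
  proof (induction w arbitrary: f)
    case (Cons r w)
    obtain d l where r: "r = (d, l)" by (cases r)
    have IH: "subst i k (cre (c, j) g) w =
      cre (c, j) (subst i k g) w + free_const (of_bool (i = j)) * cre (c, k) g w" for g
      using Cons by simp
    show ?case
      by (auto simp: r ann_cre ann_subst lin_simps[OF lin_cre] lin_simps[OF lin_subst] IH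
          mode_parity_def algebra_simps free_const_minus)
  qed simp
qed

text \<open>The negatives of these operators satisfy the relations of gl(n), which explains the
  minus sign in \<open>raise\<close>.\<close>

lemma subst_subst: "subst i k (subst j l f) - subst j l (subst i k f) =
    scal (of_bool (i = l)) (subst j k f) - scal (of_bool (k = j)) (subst i l f)"
proof (rule ext)
  fix w show "(subst i k (subst j l f) - subst j l (subst i k f)) w =
    (scal (of_bool (i = l)) (subst j k f) - scal (of_bool (k = j)) (subst i l f)) w"
  proof (induction w arbitrary: f)
    case (Cons r w)
    obtain d m where r: "r = (d, m)" by (cases r)
    have IH: "subst i k (subst j l g) w = subst j l (subst i k g) w +
      free_const (of_bool (i = l)) * subst j k g w - free_const (of_bool (k = j)) * subst i l g w" for g
      using Cons[of g] by (simp add: algebra_simps)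
    show ?case
      by (auto simp: r ann_subst lin_simps[OF lin_subst] IH  algebra_simps)
  qed simp
qed

lemma free_const_commute_free_const:
  "free_const a * (free_const b * f) = free_const b * (free_const a * f)"
  by (simp add: free_const_mult_left mult.commute)

section \<open>Raising and lowering operators\<close>

definition lower :: "sym \<Rightarrow> nat \<Rightarrow> fock \<Rightarrow> fock" where
  "lower b j f = (case b of Low i \<Rightarrow> scal (of_bool (i = j)) f | _ \<Rightarrow> ann (b, j) f)"

text \<open>\<open>raise a j\<close> represents e_{a,j}. If \<open>a = Low i\<close>, this letter
  must first pass the modes, where e_{i,j} e_{c,i} = e_{c,i} e_{i,j} - e_{c,j} produces the
  subtracted \<open>subst i j\<close>, and then multiplies the value. The delta in
  \<open>lower\<close> for symbols of L gives all basis elements the common form used in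
  \<open>rep\<close>.\<close>

definition raise :: "sym \<Rightarrow> nat \<Rightarrow> fock \<Rightarrow> fock" where
  "raise a j f =
     (case a of Low i \<Rightarrow> (\<lambda>w. letter (Low i, Low j) * f w) - subst i j f | _ \<Rightarrow> cre (a, j) f)"

lemma lin_lower: "lin (lower b j)"
  by (rule linI; cases b)
    (simp_all add: lower_def fock.scale_right_distrib fock.scale_left_commute)

lemma lin_raise: "lin (raise a j)"
proof (cases a)
  case (Low i)
  show ?thesis
    by (rule linI)
      (auto simp: raise_def Low lin_simps[OF lin_subst] fun_eq_iff algebra_simps free_const_left_commute)
qed (auto simp: raise_def[abs_def] lin_cre)

text \<open>If \<open>b\<close> is in L, lowering is a scalar and the last two terms cancel. If
  \<open>b\<close> is virtual, this is \<open>ann_cre\<close> or \<open>ann_subst\<close>, and the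
  case term is the contribution of the subtracted \<open>subst\<close>.\<close>

lemma lower_raise: "lower b j (raise c k f) =
   scal ((-1) ^ ((sym_parity b + 1) * (sym_parity c + 1))) (raise c k (lower b j f)) +
   scal (of_bool (j = k))
     (scal (of_bool (b = c)) f - (case c of Low i \<Rightarrow> lower b i f | _ \<Rightarrow> 0))"
proof (cases "\<exists>i. b = Low i")
  case True
  then show ?thesis
    by (cases c) (auto simp: lower_def lin_simps[OF lin_raise] module_hom.zero[OF lin_raise])
next
  case False
  then have b: "lower b j f = ann (b, j) f" for j f
    by (cases b) (simp_all add: lower_def)
  show ?thesis
  proof (cases c)
    case (Low i)
    have "ann (b, j) (\<lambda>w. g * f w) = (\<lambda>w. g * ann (b, j) f w)" for g
      by (simp add: ann_def)
    then show ?thesis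
      using False by (auto simp: b raise_def Low ann_subst algebra_simps)
  qed (auto simp: b raise_def ann_cre mode_parity_def add.commute)
qed

section \<open>Supersymmetric functions and their stability\<close>

definition supersym :: "fock \<Rightarrow> bool" where
  "supersym f \<longleftrightarrow> (\<forall>u p q w.
     f (u @ p # q # w) = free_const ((-1) ^ (mode_parity p * mode_parity q)) * f (u @ q # p # w))"

lemma supersymI:
  assumes "\<And>u p q w. f (u @ p # q # w) =
    free_const ((-1) ^ (mode_parity p * mode_parity q)) * f (u @ q # p # w)"
  shows "supersym f"
  unfolding supersym_def using assms by blast

lemma supersymD:
  "supersym f \<Longrightarrow> f (u @ p # q # w) =
    free_const ((-1) ^ (mode_parity p * mode_parity q)) * f (u @ q # p # w)"
  unfolding supersym_def by blast

lemma supersym_ann: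
  assumes "supersym f" shows "supersym (ann p f)"
proof (rule supersymI)
  fix u q r w
  show "ann p f (u @ q # r # w) =
      free_const ((-1) ^ (mode_parity q * mode_parity r)) * ann p f (u @ r # q # w)"
    using supersymD[OF assms, of "p # u" q r w] by (simp add: ann_def)
qed

lemma supersym_ann_ann:
  assumes "supersym f"
  shows "ann p (ann q f) = scal ((-1) ^ (mode_parity p * mode_parity q)) (ann q (ann p f))"
  using supersymD[OF assms, of "[]" q p]
  by (simp add: ann_def fun_eq_iff mult.commute)

lemma supersym_add:
  assumes "supersym f" "supersym g" shows "supersym (f + g)"
proof (rule supersymI)
  fix u p q w
  show "(f + g) (u @ p # q # w) =
      free_const ((-1) ^ (mode_parity p * mode_parity q)) * (f + g) (u @ q # p # w)"
    using supersymD[OF assms(1), of u p q w] supersymD[OF assms(2), of u p q w]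
    by (simp add: distrib_left)
qed

lemma supersym_left_mult:
  assumes "supersym f" shows "supersym (\<lambda>w. g * f w)"
  by (rule supersymI, subst supersymD[OF assms]) (rule free_const_left_commute[symmetric])

lemma supersym_scal: "supersym f \<Longrightarrow> supersym (scal c f)"
  unfolding scal_def by (rule supersym_left_mult)

lemma supersym_cre:
  assumes "supersym f" shows "supersym (cre p f)"
proof (rule supersymI)
  fix u q r w
  show "cre p f (u @ q # r # w) =
      free_const ((-1) ^ (mode_parity q * mode_parity r)) * cre p f (u @ r # q # w)"
    using assms
  proof (induction u arbitrary: f)
    \<comment> \<open>For an exchange at the front of the word, the two single contractions change
      places, and the double contraction is governed by the supersymmetry of
      \<open>f\<close>.\<close>
    case Nil
    define s where "s p q = (-1 :: complex) ^ (mode_parity p * mode_parity q)" for p q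
    have s: "s p q = s q p" "s p q * s p q = 1" for p q
      unfolding s_def by (simp_all add: mult.commute flip: power_add)
    have s3: "s p q * (s p q * x) = x" for p q x
      by (simp add: s(2) flip: mult.assoc)
    have f: "ann r (ann q f) = scal (s r q) (ann q (ann r f))"
      using supersym_ann_ann[OF Nil, of r q] by (simp add: s_def)
    have f': "ann q f (r # w) = ann r (ann q f) w" for q r
      by (simp add: ann_def)
    have 1: "cre p f (q # r # w) = free_const (of_bool (p = q)) * ann r f w +
      free_const (s p q) * (free_const (of_bool (p = r)) * ann q f w +
      free_const (s p r) * cre p (ann r (ann q f)) w)" for q r
      by (simp add: s_def ann_def)
    have 2: "cre p (ann r (ann q f)) w = free_const (s r q) * cre p (ann q (ann r f)) w"
      by (simp only: f lin_simps(3)[OF lin_cre]) simp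
    have "cre p f (q # r # w) = free_const (s q r) * cre p f (r # q # w)"
      unfolding 1[of q r] 1[of r q] 2
      by (auto simp: distrib_left free_const_mult_left s(2) s3 s(1)[of r q] s(1)[of r p] ac_simps)
    then show ?case
      unfolding append_Nil s_def .
  next
    case (Cons t u)
    have "f (u @ q # r # w) =
        free_const ((-1) ^ (mode_parity q * mode_parity r)) * f (u @ r # q # w)"
      by (rule supersymD[OF Cons.prems])
    then show ?case
      using Cons.IH[OF supersym_ann[OF Cons.prems]]
      by (simp add: distrib_left free_const_commute_free_const)
  qed
qed

lemma supersym_subst:
  assumes "supersym f" shows "supersym (subst i k f)"
proof (rule supersymI)
  fix u q r w
  show "subst i k f (u @ q # r # w) =
      free_const ((-1) ^ (mode_parity q * mode_parity r)) * subst i k f (u @ r # q # w)"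
    using assms
  proof (induction u arbitrary: f)
    case Nil
    obtain c j d l where qr: "q = (c, j)" "r = (d, l)"
      by (cases q, cases r)
    \<comment> \<open>Substitution changes only second indices, so modified modes are exchanged with
      the same sign.\<close>
    define e where "e = (-1 :: complex) ^ ((sym_parity c + 1) * (sym_parity d + 1))"
    have e: "(-1 :: complex) ^ (mode_parity (c, j) * mode_parity (d, l)) = e"
      "(-1 :: complex) ^ (mode_parity (d, j) * mode_parity (c, l)) = e" for j l
      by (simp_all add: mode_parity_def e_def mult.commute)
    have f: "f ((c, j) # (d, l) # w) = free_const e * f ((d, l) # (c, j) # w)" for j l w
      using supersymD[OF Nil, of "[]" "(c, j)" "(d, l)" w] by (simp add: e)
    have g: "ann (d, l) (ann (c, j) f) = scal e (ann (c, j) (ann (d, l) f))" for j l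
      by (simp add: fun_eq_iff ann_def f)
    have 1: "subst i k f ((c, j) # (d, l) # w) = free_const (of_bool (j = k)) * f ((c, i) # (d, l) # w)
       + (free_const (of_bool (l = k)) * f ((c, j) # (d, i) # w)
         + subst i k (ann (d, l) (ann (c, j) f)) w)" for c j d l
      by (simp add: ann_def)
    show ?case
      unfolding append_Nil qr e 1 f g lin_simps(3)[OF lin_subst] scal_apply
      by (simp add: distrib_left free_const_commute_free_const add.left_commute)
  next
    case (Cons t u)
    have "f ((c, i) # u @ q # r # w) =
        free_const ((-1) ^ (mode_parity q * mode_parity r)) * f ((c, i) # u @ r # q # w)" for c
      using supersymD[OF Cons.prems, of "(c, i) # u" q r w] by simp
    then show ?case
      using Cons.IH[OF supersym_ann[OF Cons.prems]]
      by (cases t) (simp add: distrib_left free_const_commute_free_const)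
  qed
qed

lemma supersym_zero: "supersym 0"
  by (simp add: supersym_def)

lemma supersym_minus: "supersym f \<Longrightarrow> supersym g \<Longrightarrow> supersym (f - g)"
  using supersym_add[of f "scal (-1) g"] supersym_scal[of g "-1"] by simp

lemma supersym_sum: "(\<And>x. x \<in> X \<Longrightarrow> supersym (F x)) \<Longrightarrow> supersym (\<Sum>x\<in>X. F x)"
  by (induction X rule: infinite_finite_induct) (auto intro: supersym_zero supersym_add)

lemma supersym_raise: "supersym f \<Longrightarrow> supersym (raise a j f)"
  unfolding raise_def
  by (cases a) (auto intro: supersym_cre supersym_minus supersym_left_mult supersym_subst)

lemma supersym_lower: "supersym f \<Longrightarrow> supersym (lower b j f)"
  unfolding lower_def by (cases b) (auto intro: supersym_ann supersym_scal supersym_zero)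

lemma lower_lower:
  assumes "supersym f"
  shows "lower b j (lower d k f) =
    scal ((-1) ^ ((sym_parity b + 1) * (sym_parity d + 1))) (lower d k (lower b j f))"
  using supersym_ann_ann[OF assms, of "(b, j)" "(d, k)"]
  by (cases b; cases d) (simp_all add: lower_def mode_parity_def add.commute mult.commute)

section \<open>Brackets of the represented operators\<close>

definition raise_defect :: "sym \<Rightarrow> nat \<Rightarrow> sym \<Rightarrow> nat \<Rightarrow> fock \<Rightarrow> fock" where
  "raise_defect a j c k f =
     raise a j (raise c k f)
     - scal ((-1) ^ ((sym_parity a + 1) * (sym_parity c + 1))) (raise c k (raise a j f))
     - (case c of Low i \<Rightarrow> scal (of_bool (i = j)) (raise a k f) | _ \<Rightarrow> 0)
     + (case a of Low i \<Rightarrow> scal (of_bool (i = k)) (raise c j f) | _ \<Rightarrow> 0)"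

text \<open>Creation has scalar coefficients, hence commutes with multiplication of the values by a
  letter, and \<open>subst_cre\<close> supplies exactly the required bracket. So these relations
  hold before any quotient is taken.\<close>

lemma raise_defect_virtual:
  assumes "(\<forall>i. a \<noteq> Low i) \<or> (\<forall>i. c \<noteq> Low i)"
  shows "raise_defect a j c k f = 0"
proof -
  have l: "cre p (\<lambda>w. letter (Low i, Low j) * f w) = (\<lambda>w. letter (Low i, Low j) * cre p f w)" for p i j
  proof
    fix w show "cre p (\<lambda>w. letter (Low i, Low j) * f w) w = letter (Low i, Low j) * cre p f w"
    proof (induction w arbitrary: f)
      case (Cons q w)
      have a: "ann q (\<lambda>w. letter (Low i, Low j) * f w) = (\<lambda>w. letter (Low i, Low j) * ann q f w)"
        by (simp add: ann_def)
      show ?case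
        by (simp add: a Cons distrib_left free_const_left_commute[of _ "letter _"])
    qed simp
  qed
  show ?thesis
    using assms cre_cre[of "(a, j)" "(c, k)" f] unfolding raise_defect_def raise_def
    by (cases a; cases c)
      (auto simp: mode_parity_def add.commute lin_simps[OF lin_cre] l subst_cre algebra_simps)
qed

text \<open>Multiplication of values commutes with \<open>subst\<close>, and the
  \<open>subst\<close> parts satisfy their relations exactly by \<open>subst_subst\<close>. Only the
  relation of gl(n), multiplied onto the values, survives.\<close>

lemma raise_defect_Low:
  "raise_defect (Low i) j (Low i') k f = (\<lambda>w.
     (letter (Low i, Low j) * letter (Low i', Low k) - letter (Low i', Low k) * letter (Low i, Low j)
      - free_const (of_bool (i' = j)) * letter (Low i, Low k)
      + free_const (of_bool (i = k)) * letter (Low i', Low j)) * f w)"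
proof -
  have s: "subst i j (\<lambda>w. g * f w) = (\<lambda>w. g * subst i j f w)" for i j g f
  proof
    fix w show "subst i j (\<lambda>w. g * f w) w = g * subst i j f w"
    proof (induction w arbitrary: f)
      case (Cons q w)
      have a: "ann q (\<lambda>w. g * f w) = (\<lambda>w. g * ann q f w)"
        for q by (simp add: ann_def)
      show ?case
        by (cases q) (simp add: a Cons distrib_left free_const_left_commute[of _ g])
    qed simp
  qed
  have ss: "subst i j (subst i' k f) w = subst i' k (subst i j f) w +
    free_const (of_bool (i = k)) * subst i' j f w - free_const (of_bool (j = i')) * subst i k f w" for w
    using fun_cong[OF subst_subst[of i j i' k f], of w] by (simp add: algebra_simps)
  show ?thesis
    unfolding raise_defect_def raise_def
    by (auto simp: lin_simps[OF lin_subst] s ss fun_eq_iff algebra_simps eq_commute[of j i'])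
qed

text \<open>The operator of e_{a,b}. For \<open>b = Low i\<close> with \<open>i\<close> in range,
  the delta in \<open>lower\<close> leaves just \<open>raise a i\<close>.\<close>

definition rep :: "nat \<Rightarrow> sym \<times> sym \<Rightarrow> fock \<Rightarrow> fock" where
  "rep n s f = (\<Sum>j\<in>{1..n}. raise (fst s) j (lower (snd s) j f))"

lemma lin_rep: "lin (rep n s)"
  by (rule linI)
    (simp_all add: rep_def lin_simps[OF lin_raise] lin_simps[OF lin_lower] sum.distrib fock.scale_sum_right)

lemma supersym_rep: "supersym f \<Longrightarrow> supersym (rep n s f)"
  unfolding rep_def by (intro supersym_sum supersym_raise supersym_lower)

text \<open>The sign for exchanging e_{a,j} and e_{b,k} with j and k in L.\<close>

definition pair_sign :: "sym \<Rightarrow> sym \<Rightarrow> complex" where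
  "pair_sign a b = (-1) ^ ((sym_parity a + 1) * (sym_parity b + 1))"

lemma pair_sign_commute: "pair_sign a b = pair_sign b a"
  by (simp add: pair_sign_def mult.commute)

lemma pair_sign_Low [simp]: "pair_sign (Low i) b = 1" "pair_sign b (Low i) = 1"
  by (simp_all add: pair_sign_def)

text \<open>Modulo 2 the parity |a| + |b| equals (|a| + 1) + (|b| + 1), so the exponent expands
  bilinearly into four products.\<close>

lemma elem_parity_sign:
  "(-1 :: complex) ^ (elem_parity (a, b) * elem_parity (c, d)) =
    pair_sign a c * pair_sign a d * pair_sign b c * pair_sign b d"
  by (cases a; cases b; cases c; cases d) (simp_all add: elem_parity_def pair_sign_def)

lemma pair_sign_square [simp]: "pair_sign a b * pair_sign a b = 1"
    "pair_sign a b * (pair_sign a b * x) = x"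
proof -
  show 1: "pair_sign a b * pair_sign a b = 1"
    by (simp add: pair_sign_def flip: power_add)
  show "pair_sign a b * (pair_sign a b * x) = x"
    by (simp add: 1 flip: mult.assoc)
qed

text \<open>Normal ordering: \<open>lower_raise\<close> moves both raising operators to the left of
  both lowering operators, and its terms with \<open>j = k\<close> give the contraction and the
  correction for \<open>c\<close> in L.\<close>

lemma rep_rep:
  "rep n (a, b) (rep n (c, d) f) =
    scal (pair_sign b c)
      (\<Sum>j\<in>{1..n}. \<Sum>k\<in>{1..n}. raise a j (raise c k (lower b j (lower d k f))))
    + scal (of_bool (b = c)) (rep n (a, d) f)
    - (case c of Low i \<Rightarrow> \<Sum>j\<in>{1..n}. raise a j (lower b i (lower d j f)) | _ \<Rightarrow> 0)"
proof -
  note lin = lin_simps[OF lin_raise] lin_simps[OF lin_lower]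
    module_hom.sum[OF lin_raise] module_hom.sum[OF lin_lower]
  define K where "K g = (case c of Low i \<Rightarrow> lower b i g | _ \<Rightarrow> 0)" for g
  have "rep n (a, b) (rep n (c, d) f) =
      (\<Sum>j\<in>{1..n}. \<Sum>k\<in>{1..n}.
        scal (pair_sign b c) (raise a j (raise c k (lower b j (lower d k f))))
        + scal (of_bool (j = k)) (scal (of_bool (b = c)) (raise a j (lower d k f))
            - raise a j (K (lower d k f))))"
    unfolding rep_def fst_conv snd_conv lin lower_raise pair_sign_def[symmetric] K_def ..
  also have "\<dots> = scal (pair_sign b c)
        (\<Sum>j\<in>{1..n}. \<Sum>k\<in>{1..n}. raise a j (raise c k (lower b j (lower d k f))))
      + (\<Sum>j\<in>{1..n}. \<Sum>k\<in>{1..n}. scal (of_bool (j = k))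
          (scal (of_bool (b = c)) (raise a j (lower d k f)) - raise a j (K (lower d k f))))"
    by (simp only: sum.distrib fock.scale_sum_right)
  also have "(\<Sum>j\<in>{1..n}. \<Sum>k\<in>{1..n}. scal (of_bool (j = k))
          (scal (of_bool (b = c)) (raise a j (lower d k f)) - raise a j (K (lower d k f))))
      = (\<Sum>j\<in>{1..n}. scal (of_bool (b = c)) (raise a j (lower d j f)) - raise a j (K (lower d j f)))"
    (is "_ = sum ?h _")
  proof (rule sum.cong[OF refl])
    fix j assume "j \<in> {1..n}"
    then have "(\<Sum>k\<in>{1..n}. scal (of_bool (j = k)) (F k)) = F j" for F
      by (simp add: of_bool_def if_distrib[of "\<lambda>c. scal c _"] if_distrib[of scal] if_distribR cong: if_cong)
    then show "(\<Sum>k\<in>{1..n}. scal (of_bool (j = k))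
        (scal (of_bool (b = c)) (raise a j (lower d k f)) - raise a j (K (lower d k f)))) = ?h j" .
  qed
  also have "\<dots> = scal (of_bool (b = c)) (rep n (a, d) f)
      - (case c of Low i \<Rightarrow> \<Sum>j\<in>{1..n}. raise a j (lower b i (lower d j f)) | _ \<Rightarrow> 0)"
    by (cases c) (simp_all add: rep_def sum_subtractf fock.scale_sum_right K_def
        module_hom.zero[OF lin_raise])
  finally show ?thesis
    by (simp only: add_diff_eq)
qed

text \<open>The operators fail to satisfy the brackets only by the defects of the \<open>raise\<close>, which vanish
  modulo the relations of \<open>gl(n)\<close>.\<close>

lemma rep_bracket:
  assumes f: "supersym f"
    and a: "\<And>i. a = Low i \<Longrightarrow> i \<in> {1..n}" and c: "\<And>i. c = Low i \<Longrightarrow> i \<in> {1..n}"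
    and e_def: "e = (-1) ^ (elem_parity (a, b) * elem_parity (c, d))"
  shows "rep n (a, b) (rep n (c, d) f) - scal e (rep n (c, d) (rep n (a, b) f))
      - scal (of_bool (b = c)) (rep n (a, d) f) + scal (e * of_bool (a = d)) (rep n (c, b) f)
    = scal (pair_sign b c) (\<Sum>j\<in>{1..n}. \<Sum>k\<in>{1..n}. raise_defect a j c k (lower b j (lower d k f)))"
proof -
  define g where "g j k = lower b j (lower d k f)" for j k
  define P where "P = (case c of Low i \<Rightarrow> \<Sum>j\<in>{1..n}. raise a j (g i j) | _ \<Rightarrow> 0)"
  define Q where "Q = (case a of Low i \<Rightarrow> \<Sum>k\<in>{1..n}. raise c k (g k i) | _ \<Rightarrow> 0)"
  define A where "A = (\<Sum>j\<in>{1..n}. \<Sum>k\<in>{1..n}. raise a j (raise c k (g j k)))"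
  define B where "B = (\<Sum>j\<in>{1..n}. \<Sum>k\<in>{1..n}. raise c k (raise a j (g j k)))"
  define D where "D = (\<Sum>j\<in>{1..n}. \<Sum>k\<in>{1..n}. raise_defect a j c k (g j k))"
  have e: "e = pair_sign a c * pair_sign a d * pair_sign b c * pair_sign b d"
    unfolding e_def by (rule elem_parity_sign)
  have g: "lower d k (lower b j f) = scal (pair_sign b d) (g j k)" for j k
    using lower_lower[OF f, of d k b j] by (simp add: g_def pair_sign_def mult.commute)
  have 1: "rep n (a, b) (rep n (c, d) f) =
      scal (pair_sign b c) A + scal (of_bool (b = c)) (rep n (a, d) f) - P"
    unfolding rep_rep A_def P_def g_def ..
  \<comment> \<open>To be comparable with \<open>1\<close>, the double sum is interchanged and the
    lowering operators are reordered at the cost of \<open>pair_sign b d\<close>. Supersymmetry of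
    \<open>f\<close> enters here, through \<open>g\<close>.\<close>
  have 2: "rep n (c, d) (rep n (a, b) f) = scal (pair_sign a d * pair_sign b d) B
      + scal (of_bool (a = d)) (rep n (c, b) f) - scal (pair_sign b d) Q"
    unfolding rep_rep[of n c d a b] B_def Q_def g
    by (subst sum.swap, cases a)
      (simp_all add: lin_simps[OF lin_raise] pair_sign_commute[of d] eq_commute[of d]
        flip: fock.scale_sum_right)
  have of_bool_sum: "(\<Sum>j\<in>X. scal (of_bool (i = j)) (F j)) = F i" if "i \<in> X" "finite X" for i F X
    using that by (simp add: of_bool_def if_distrib[of scal] if_distribR cong: if_cong)
  have P: "(\<Sum>j\<in>{1..n}. \<Sum>k\<in>{1..n}.
      (case c of Low i \<Rightarrow> scal (of_bool (i = j)) (raise a k (g j k)) | _ \<Rightarrow> 0)) = P"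
    using c by (cases c) (simp_all add: P_def of_bool_sum flip: fock.scale_sum_right)
  have Q: "(\<Sum>j\<in>{1..n}. \<Sum>k\<in>{1..n}.
      (case a of Low i \<Rightarrow> scal (of_bool (i = k)) (raise c j (g j k)) | _ \<Rightarrow> 0)) = Q"
    using a by (cases a) (simp_all add: Q_def of_bool_sum)
  have D: "D = A - scal (pair_sign a c) B - P + Q"
    unfolding D_def raise_defect_def pair_sign_def[symmetric] sum.distrib sum_subtractf P Q
    by (simp only: A_def B_def fock.scale_sum_right)
  \<comment> \<open>\<open>P\<close> can be nonzero only for \<open>c\<close> in L and
    \<open>Q\<close> only for \<open>a\<close> in L, and signs involving a symbol of L are
    1.\<close>
  have P1: "scal (pair_sign b c) P = P"
    by (cases c) (simp_all add: P_def)
  have Q1: "scal (pair_sign b c) Q = scal (e * pair_sign b d) Q"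
    by (cases a) (simp_all add: Q_def e ac_simps)
  have eB: "e * (pair_sign a d * pair_sign b d) = pair_sign b c * pair_sign a c"
    unfolding e by (simp add: ac_simps)
  show ?thesis
    unfolding g_def[symmetric] D_def[symmetric] D 1 2
    by (simp add: fock.scale_right_distrib fock.scale_right_diff_distrib eB P1 Q1)
qed

text \<open>The simplifier eta-contracts these rules and would rewrite unapplied functions with them.\<close>

declare scal_apply [simp del] plus_fun_apply [simp del] minus_apply [simp del]

lemma free_induct [case_names single add]:
  assumes "\<And>v c. P (Poly_Mapping.single v c)" "\<And>f g. P f \<Longrightarrow> P g \<Longrightarrow> P (f + g)"
  shows "P (f :: 'g free)"
proof -
  have "P (\<Sum>v \<in> X. Poly_Mapping.single v (Poly_Mapping.lookup f v))" if "finite X" for X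
    using that
  proof induction
    case empty
    show ?case using assms(1)[of 0 0] by simp
  qed (simp add: assms)
  then show ?thesis
    by (metis sum_single finite_keys)
qed

section \<open>Action of the free algebra on functions\<close>

definition act :: "nat \<Rightarrow> (sym \<times> sym) free \<Rightarrow> fock \<Rightarrow> fock" where
  "act n g f = (\<Sum>v\<in>Poly_Mapping.keys g.
     scal (Poly_Mapping.lookup g v) (foldr (rep n) (letters v) f))"

lemma act_superset:
  "finite X \<Longrightarrow> Poly_Mapping.keys g \<subseteq> X \<Longrightarrow>
    act n g f = (\<Sum>v\<in>X. scal (Poly_Mapping.lookup g v) (foldr (rep n) (letters v) f))"
  unfolding act_def by (rule sum.mono_neutral_left) (auto simp: in_keys_iff)

lemma act_add: "act n (g + h) f = act n g f + act n h f"
proof -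
  let ?X = "Poly_Mapping.keys g \<union> Poly_Mapping.keys h"
  have "Poly_Mapping.keys (g + h) \<subseteq> ?X"
    by (rule keys_add)
  then show ?thesis
    by (simp add: act_superset[of ?X] lookup_add fock.scale_left_distrib sum.distrib)
qed

lemma act_single: "act n (Poly_Mapping.single v c) f = scal c (foldr (rep n) (letters v) f)"
  by (simp add: act_superset[of "{v}"])

lemma lin_foldr_rep: "lin (foldr (rep n) v)"
  by (rule linI; induction v) (simp_all add: lin_simps[OF lin_rep])

lemma lin_act: "lin (act n g)"
  by (rule linI) (simp_all add: act_def lin_simps[OF lin_foldr_rep] fock.scale_right_distrib
      sum.distrib fock.scale_sum_right mult.commute)

lemma act_mult: "act n (g * h) f = act n g (act n h f)"
proof (induction g rule: free_induct)
  case (single v c)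
  show ?case
  proof (induction h rule: free_induct)
    case (single w d)
    show ?case
      by (simp add: mult_single act_single lin_simps[OF lin_foldr_rep])
  qed (simp add: distrib_left act_add lin_simps[OF lin_act])
qed (simp add: distrib_right act_add)

lemma act_letter: "act n (letter s) f = rep n s f"
  by (simp add: letter_def act_single)

lemma act_free_const: "act n (free_const c) f = scal c f"
  by (simp add: free_const_def act_single)

lemma act_0 [simp]: "act n 0 f = 0"
  by (simp add: act_def)

lemma act_uminus: "act n (- g) f = - act n g f"
  using act_add[of n g "- g" f] by (simp add: minus_unique)

lemma act_diff: "act n (g - h) f = act n g f - act n h f"
  using act_add[of n g "- h" f] by (simp add: act_uminus)

lemma act_sign: "act n ((-1) ^ k * g) f = scal ((-1) ^ k) (act n g f)"
  by (simp add: act_mult act_free_const flip: free_const_sign)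

section \<open>Subalgebras of the free algebra and the ideal of relations\<close>

abbreviation falg :: "'g set \<Rightarrow> 'g free set" where
  "falg X \<equiv> carrier (free_alg X)"

lemma free_alg_simps [simp]:
  "x \<oplus>\<^bsub>free_alg X\<^esub> y = x + y" "x \<otimes>\<^bsub>free_alg X\<^esub> y = x * y"
  "\<zero>\<^bsub>free_alg X\<^esub> = 0" "\<one>\<^bsub>free_alg X\<^esub> = 1"
  by (simp_all add: free_alg_def)

lemma falg_add [intro]: "f \<in> falg X \<Longrightarrow> g \<in> falg X \<Longrightarrow> f + g \<in> falg X"
  using ring.ring_simprules(1)[OF ring_free_alg] by fastforce

lemma falg_mult [intro]: "f \<in> falg X \<Longrightarrow> g \<in> falg X \<Longrightarrow> f * g \<in> falg X"
  using ring.ring_simprules(5)[OF ring_free_alg] by fastforce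

lemma falg_uminus [intro]: "f \<in> falg X \<Longrightarrow> - f \<in> falg X"
  by (simp add: free_alg_def)

lemma falg_diff [intro]: "f \<in> falg X \<Longrightarrow> g \<in> falg X \<Longrightarrow> f - g \<in> falg X"
  using falg_add[of f X "- g"] by auto

lemma falg_0 [intro, simp]: "0 \<in> falg X"
  by (simp add: free_alg_def)

lemma falg_single: "set (letters v) \<subseteq> X \<Longrightarrow> Poly_Mapping.single v c \<in> falg X"
  by (simp add: free_alg_def)

lemma falg_free_const [intro, simp]: "free_const c \<in> falg X"
  by (simp add: free_const_def falg_single)

lemma falg_1 [intro, simp]: "1 \<in> falg X"
  using falg_free_const[of 1] by simp

lemma falg_letter [intro]: "s \<in> X \<Longrightarrow> letter s \<in> falg X"
  by (simp add: letter_def falg_single)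

lemma falg_sign [intro]: "f \<in> falg X \<Longrightarrow> (-1) ^ k * f \<in> falg X"
  by (cases "even k") auto

lemma falg_mono: "X \<subseteq> Y \<Longrightarrow> falg X \<subseteq> falg Y"
  by (auto simp: free_alg_def)

lemma a_inv_free_alg: "f \<in> falg X \<Longrightarrow> \<ominus>\<^bsub>free_alg X\<^esub> f = - f"
  using abelian_group.minus_equality[OF ring.is_abelian_group[OF ring_free_alg], of X "- f" f] by auto

abbreviation glb :: "nat \<Rightarrow> nat \<Rightarrow> nat \<Rightarrow> (sym \<times> sym) set" where
  "glb m0 m1 n \<equiv> basis (gl m0 m1 n)"

abbreviation gli :: "nat \<Rightarrow> nat \<Rightarrow> nat \<Rightarrow> (sym \<times> sym) free set" where
  "gli m0 m1 n \<equiv> env_ideal (gl m0 m1 n)"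

abbreviation cls :: "nat \<Rightarrow> nat \<Rightarrow> nat \<Rightarrow> (sym \<times> sym) free \<Rightarrow> (sym \<times> sym) free set" where
  "cls m0 m1 n \<equiv> env_class (gl m0 m1 n)"

lemma ideal_gli: "ideal (gli m0 m1 n) (free_alg (glb m0 m1 n))"
  unfolding env_ideal_def by (intro ring.genideal_ideal ring_free_alg env_relations_gl)

lemma gli_subset: "f \<in> gli m0 m1 n \<Longrightarrow> f \<in> falg (glb m0 m1 n)"
  using ideal_gli ideal.Icarr by fast

lemma gli_0 [simp]: "0 \<in> gli m0 m1 n"
  using additive_subgroup.zero_closed[OF ideal.axioms(1)[OF ideal_gli]] by simp

lemma gli_add: "f \<in> gli m0 m1 n \<Longrightarrow> g \<in> gli m0 m1 n \<Longrightarrow> f + g \<in> gli m0 m1 n"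
  using additive_subgroup.a_closed[OF ideal.axioms(1)[OF ideal_gli], of f m0 m1 n g] by simp

lemma gli_lmult: "f \<in> gli m0 m1 n \<Longrightarrow> g \<in> falg (glb m0 m1 n) \<Longrightarrow> g * f \<in> gli m0 m1 n"
  using ideal.I_l_closed[OF ideal_gli, of f m0 m1 n g] by simp

lemma gli_rmult: "f \<in> gli m0 m1 n \<Longrightarrow> g \<in> falg (glb m0 m1 n) \<Longrightarrow> f * g \<in> gli m0 m1 n"
  using ideal.I_r_closed[OF ideal_gli, of f m0 m1 n g] by simp

lemma gli_uminus: "f \<in> gli m0 m1 n \<Longrightarrow> - f \<in> gli m0 m1 n"
  using gli_lmult[of f m0 m1 n "- 1"] by auto

section \<open>The bracket relations\<close>

lemma single_letter: "Poly_Mapping.single (Word [s]) c = free_const c * letter s"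
  by (simp add: free_const_def letter_def mult_single)

lemma tensor1_superset:
  "finite X \<Longrightarrow> Poly_Mapping.keys x \<subseteq> X \<Longrightarrow>
    tensor1 x = (\<Sum>s\<in>X. free_const (Poly_Mapping.lookup x s) * letter s)"
proof -
  assume X: "finite X" "Poly_Mapping.keys x \<subseteq> X"
  have "tensor1 x = (\<Sum>s\<in>Poly_Mapping.keys x. free_const (Poly_Mapping.lookup x s) * letter s)"
    by (simp add: tensor1_def single_letter)
  also have "\<dots> = (\<Sum>s\<in>X. free_const (Poly_Mapping.lookup x s) * letter s)"
    using X by (intro sum.mono_neutral_left) (auto simp: in_keys_iff)
  finally show ?thesis .
qed

lemma tensor1_add: "tensor1 (x + y) = tensor1 x + tensor1 y"
  using keys_add[of x y]
  by (simp add: tensor1_superset[of "Poly_Mapping.keys x \<union> Poly_Mapping.keys y"]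
      lookup_add distrib_right sum.distrib flip: free_const_add)

lemma tensor1_single: "tensor1 (Poly_Mapping.single s c) = free_const c * letter s"
  by (simp add: tensor1_superset[of "{s}"])

lemma tensor1_0 [simp]: "tensor1 0 = 0"
  by (simp add: tensor1_def)

lemma tensor1_diff: "tensor1 (x - y) = tensor1 x - tensor1 y"
  using tensor1_add[of "x - y" y] by (simp add: algebra_simps)

lemma tensor1_sum: "tensor1 (\<Sum>x\<in>X. F x) = (\<Sum>x\<in>X. tensor1 (F x))"
  by (induction X rule: infinite_finite_induct) (simp_all add: tensor1_add)

lemma tensor1_map: "tensor1 (Poly_Mapping.map (\<lambda>d. c * d) x) = free_const c * tensor1 x"
proof -
  have "Poly_Mapping.keys (Poly_Mapping.map (\<lambda>d. c * d) x) \<subseteq> Poly_Mapping.keys x"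
    by (auto simp: in_keys_iff map.rep_eq when_def)
  then show ?thesis
    by (simp add: tensor1_superset[of "Poly_Mapping.keys x"] sum_distrib_left map.rep_eq when_def
        in_keys_iff free_const_mult_left)
qed

definition bracket_relation :: "sym \<times> sym \<Rightarrow> sym \<times> sym \<Rightarrow> (sym \<times> sym) free" where
  "bracket_relation s t =
     letter s * letter t - (-1) ^ (elem_parity s * elem_parity t) * (letter t * letter s)
     - tensor1 (elem_bracket s t)"

lemma tensor1_elem_bracket:
  "tensor1 (elem_bracket (a, b) (c, d)) = free_const (of_bool (b = c)) * letter (a, d)
     - free_const ((-1) ^ (elem_parity (a, b) * elem_parity (c, d)) * of_bool (a = d)) * letter (c, b)"
  by (simp add: elem_bracket_def tensor1_diff tensor1_single)

lemma elem_parity_cases: "elem_parity s \<in> {0, 1}"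
  unfolding elem_parity_def by (cases s) auto

lemma bracket_relation_in_gli:
  assumes "s \<in> glb m0 m1 n" "t \<in> glb m0 m1 n"
  shows "bracket_relation s t \<in> gli m0 m1 n"
proof -
  let ?g = "gl m0 m1 n"
  have 1: "lbracket ?g (Poly_Mapping.single s 1) (Poly_Mapping.single t 1) = elem_bracket s t"
    by (simp add: lbracket_def gl_def poly_mapping_eq_iff map.rep_eq fun_eq_iff when_def)
  have hom: "Poly_Mapping.single s 1 \<in> homogeneous ?g (elem_parity s)" if "s \<in> glb m0 m1 n" for s
    using that by (simp add: homogeneous_def gl_def)
  have "\<exists>x y p q. bracket_relation s t =
      tensor1 x * tensor1 y - (-1) ^ (p * q) * (tensor1 y * tensor1 x) - tensor1 (lbracket ?g x y) \<and>
      p \<in> {0, 1} \<and> q \<in> {0, 1} \<and> x \<in> homogeneous ?g p \<and> y \<in> homogeneous ?g q"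
    using assms elem_parity_cases[of s] elem_parity_cases[of t] hom[of s] hom[of t]
    by (intro exI[of _ "Poly_Mapping.single s 1"] exI[of _ "Poly_Mapping.single t 1"]
        exI[of _ "elem_parity s"] exI[of _ "elem_parity t"])
      (simp add: 1 bracket_relation_def tensor1_single)
  then have "bracket_relation s t \<in> env_relations ?g"
    unfolding env_relations_def by blast
  then show ?thesis
    unfolding env_ideal_def
    using ring.genideal_self[OF ring_free_alg env_relations_gl] by blast
qed

text \<open>By bilinearity, the relations for arbitrary homogeneous elements are combinations of
  those for basis elements, so only the latter have to be tested on the Fock space.\<close>

lemma env_relation_expand:
  assumes "x \<in> homogeneous (gl m0 m1 n) p" "y \<in> homogeneous (gl m0 m1 n) q"
  shows "tensor1 x * tensor1 y - (-1) ^ (p * q) * (tensor1 y * tensor1 x)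
      - tensor1 (lbracket (gl m0 m1 n) x y)
    = (\<Sum>s\<in>Poly_Mapping.keys x. \<Sum>t\<in>Poly_Mapping.keys y.
        free_const (Poly_Mapping.lookup x s * Poly_Mapping.lookup y t) * bracket_relation s t)"
proof -
  let ?K = "Poly_Mapping.keys" and ?x = "Poly_Mapping.lookup x" and ?y = "Poly_Mapping.lookup y"
  have t: "tensor1 z = (\<Sum>s\<in>?K z. free_const (Poly_Mapping.lookup z s) * letter s)" for z :: "sym \<times> sym \<Rightarrow>\<^sub>0 complex"
    by (rule tensor1_superset) auto
  have c: "(free_const a * f) * (free_const b * g) = free_const (a * b) * (f * g)" for a b and f g :: "(sym \<times> sym) free"
    by (metis free_const_left_commute free_const_mult_left mult.assoc mult.commute)
  have 1: "tensor1 x * tensor1 y = (\<Sum>s\<in>?K x. \<Sum>t\<in>?K y. free_const (?x s * ?y t) * (letter s * letter t))"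
    by (simp add: t[of x] t[of y] sum_product c)
  have 2: "tensor1 y * tensor1 x = (\<Sum>s\<in>?K x. \<Sum>t\<in>?K y. free_const (?x s * ?y t) * (letter t * letter s))"
    by (subst sum.swap) (simp add: t[of x] t[of y] sum_product c mult.commute)
  have 3: "tensor1 (lbracket (gl m0 m1 n) x y) =
      (\<Sum>s\<in>?K x. \<Sum>t\<in>?K y. free_const (?x s * ?y t) * tensor1 (elem_bracket s t))"
    by (simp add: lbracket_def tensor1_sum tensor1_map gl_def)
  have "(-1) ^ (p * q) * (tensor1 y * tensor1 x) = (\<Sum>s\<in>?K x. \<Sum>t\<in>?K y.
      free_const (?x s * ?y t) * ((-1) ^ (elem_parity s * elem_parity t) * (letter t * letter s)))"
    unfolding 2 sum_distrib_left
  proof (intro sum.cong refl)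
    \<comment> \<open>All basis elements occurring in a homogeneous element have its parity, so the
      sign is the same in every term.\<close>
    fix s t assume "s \<in> ?K x" "t \<in> ?K y"
    then have "elem_parity s = p" "elem_parity t = q"
      using assms by (auto simp: homogeneous_def gl_def)
    then show "(-1) ^ (p * q) * (free_const (?x s * ?y t) * (letter t * letter s)) =
        free_const (?x s * ?y t) * ((-1) ^ (elem_parity s * elem_parity t) * (letter t * letter s))"
      by (simp add: free_const_left_commute)
  qed
  then show ?thesis
    unfolding 1 3 bracket_relation_def
    by (simp add: sum_subtractf right_diff_distrib)
qed

section \<open>Sets of values preserved by the operators\<close>

lemma glb_Low: "(a, b) \<in> glb m0 m1 n \<Longrightarrow> a = Low i \<or> b = Low i \<Longrightarrow> i \<in> {1..n}"
  by (auto simp: gl_def A0_def A1_def L_def)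

lemma glb_Low_Low: "i \<in> {1..n} \<Longrightarrow> j \<in> {1..n} \<Longrightarrow> (Low i, Low j) \<in> glb m0 m1 n"
  by (auto simp: gl_def L_def)

text \<open>Covers the two sets of values that matter, the whole algebra and the ideal of relations,
  so that preservation by all operators is proved once for both.\<close>

definition left_stable :: "nat \<Rightarrow> nat \<Rightarrow> nat \<Rightarrow> (sym \<times> sym) free set \<Rightarrow> bool" where
  "left_stable m0 m1 n K \<longleftrightarrow> 0 \<in> K \<and> (\<forall>x\<in>K. \<forall>y\<in>K. x + y \<in> K) \<and>
     (\<forall>g\<in>falg (glb m0 m1 n). \<forall>x\<in>K. g * x \<in> K)"

lemma left_stable_falg: "left_stable m0 m1 n (falg (glb m0 m1 n))"
  unfolding left_stable_def by auto

lemma left_stable_gli: "left_stable m0 m1 n (gli m0 m1 n)"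
  unfolding left_stable_def by (auto intro: gli_add gli_lmult)

context
  fixes m0 m1 n :: nat and K :: "(sym \<times> sym) free set"
  assumes K: "left_stable m0 m1 n K"
begin

private lemma K_add: "x \<in> K \<Longrightarrow> y \<in> K \<Longrightarrow> x + y \<in> K"
  and K_0: "0 \<in> K"
  and K_mult: "g \<in> falg (glb m0 m1 n) \<Longrightarrow> x \<in> K \<Longrightarrow> g * x \<in> K"
  using K unfolding left_stable_def by blast+

lemma cre_stable: "range f \<subseteq> K \<Longrightarrow> cre p f w \<in> K"
proof (induction w arbitrary: f)
  case (Cons q w)
  have "range (ann q f) \<subseteq> K"
    using Cons.prems by (auto simp: ann_def)
  then show ?case
    using Cons by (auto intro!: K_add K_mult)
qed (simp add: K_0)

lemma subst_stable: "range f \<subseteq> K \<Longrightarrow> subst i k f w \<in> K"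
proof (induction w arbitrary: f)
  case (Cons q w)
  have "range (ann q f) \<subseteq> K" for q
    using Cons.prems by (auto simp: ann_def)
  then show ?case
    using Cons by (cases q) (auto intro!: K_add K_mult)
qed (simp add: K_0)

lemma scal_stable: "range (f :: fock) \<subseteq> K \<Longrightarrow> range (scal c f) \<subseteq> K"
  by (auto simp: scal_apply intro!: K_mult)

lemma add_stable: "range f \<subseteq> K \<Longrightarrow> range g \<subseteq> K \<Longrightarrow> range (f + g) \<subseteq> K"
  by (auto simp: plus_fun_apply intro!: K_add)

lemma zero_stable: "range (0 :: fock) \<subseteq> K"
  by (simp add: image_subset_iff K_0)

lemma sum_stable: "(\<And>x. x \<in> X \<Longrightarrow> range (F x) \<subseteq> K) \<Longrightarrow> range (\<Sum>x\<in>X. F x) \<subseteq> K"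
  by (induction X rule: infinite_finite_induct) (simp_all add: add_stable zero_stable K_0)

lemma diff_stable:
  fixes f g :: fock
  assumes "range f \<subseteq> K" "range g \<subseteq> K" shows "range (f - g) \<subseteq> K"
  using add_stable[OF assms(1) scal_stable[OF assms(2), of "-1"]] by simp

lemma raise_stable:
  assumes f: "range f \<subseteq> K" and a: "\<And>i. a = Low i \<Longrightarrow> i \<in> {1..n}" and j: "j \<in> {1..n}"
  shows "range (raise a j f) \<subseteq> K"
proof (cases a)
  case (Low i)
  have "letter (Low i, Low j) \<in> falg (glb m0 m1 n)"
    using a[OF Low] j by (intro falg_letter glb_Low_Low) auto
  then show ?thesis
    unfolding raise_def Low sym.case using f
    by (intro diff_stable) (auto intro: K_mult subst_stable)
qed (use f in \<open>auto simp: raise_def intro: cre_stable\<close>)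

lemma lower_stable: "range f \<subseteq> K \<Longrightarrow> range (lower b j f) \<subseteq> K"
  by (cases b) (auto simp: lower_def ann_def scal_apply intro: K_mult K_0)

lemma rep_stable: "range f \<subseteq> K \<Longrightarrow> s \<in> glb m0 m1 n \<Longrightarrow> range (rep n s f) \<subseteq> K"
  unfolding rep_def
  by (cases s, intro sum_stable raise_stable lower_stable) (auto dest: glb_Low simp del: atLeastAtMost_iff)

lemma act_stable:
  assumes "range f \<subseteq> K" "g \<in> falg (glb m0 m1 n)"
  shows "range (act n g f) \<subseteq> K"
  unfolding act_def
proof (intro sum_stable scal_stable)
  fix v assume "v \<in> Poly_Mapping.keys g"
  then have "set (letters v) \<subseteq> glb m0 m1 n"
    using assms(2) by (auto simp: free_alg_def)
  moreover have "set l \<subseteq> glb m0 m1 n \<Longrightarrow> range (foldr (rep n) l f) \<subseteq> K" for l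
    by (induction l) (simp_all add: assms(1) rep_stable del: image_subset_iff)
  ultimately show "range (foldr (rep n) (letters v) f) \<subseteq> K"
    by blast
qed

end

section \<open>The action factors through the enveloping algebra\<close>

definition fock_space :: "nat \<Rightarrow> nat \<Rightarrow> nat \<Rightarrow> fock set" where
  "fock_space m0 m1 n = {f. supersym f \<and> range f \<subseteq> falg (glb m0 m1 n)}"

lemma supersym_act: "supersym f \<Longrightarrow> supersym (act n g f)"
proof -
  assume f: "supersym f"
  have "supersym (foldr (rep n) v f)" for v
    by (induction v) (simp_all add: f supersym_rep)
  then show ?thesis
    unfolding act_def by (intro supersym_sum supersym_scal)
qed

lemma act_fock_space:
  "f \<in> fock_space m0 m1 n \<Longrightarrow> g \<in> falg (glb m0 m1 n) \<Longrightarrow> act n g f \<in> fock_space m0 m1 n"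
  by (simp add: fock_space_def act_stable[OF left_stable_falg] supersym_act)

text \<open>The annihilator of the Fock space when values are read modulo the relations. That it
  contains \<open>gli\<close> says that the enveloping algebra acts on the Fock space with such
  values.\<close>

definition act_kernel :: "nat \<Rightarrow> nat \<Rightarrow> nat \<Rightarrow> (sym \<times> sym) free set" where
  "act_kernel m0 m1 n = {g \<in> falg (glb m0 m1 n).
     \<forall>f \<in> fock_space m0 m1 n. range (act n g f) \<subseteq> gli m0 m1 n}"

text \<open>Products from the left stay in the kernel because the action preserves functions with
  values in \<open>gli\<close>; products from the right do because it preserves
  \<open>fock_space\<close>.\<close>

lemma ideal_act_kernel: "ideal (act_kernel m0 m1 n) (free_alg (glb m0 m1 n))"
proof (rule idealI[OF ring_free_alg])
  let ?R = "free_alg (glb m0 m1 n)" and ?K = "act_kernel m0 m1 n"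
  note I = left_stable_gli[of m0 m1 n]
  have neg: "- x \<in> ?K" if "x \<in> ?K" for x
  proof -
    have "range (act n (- x) f) \<subseteq> gli m0 m1 n" if "f \<in> fock_space m0 m1 n" for f
      using scal_stable[OF I, of "act n x f" "-1"] that \<open>x \<in> ?K\<close>
      by (simp add: act_kernel_def act_uminus)
    then show ?thesis
      using that by (simp add: act_kernel_def falg_uminus)
  qed
  show "subgroup ?K (add_monoid ?R)"
  proof (rule group.subgroupI)
    show "group (add_monoid ?R)"
      using ring.is_abelian_group[OF ring_free_alg] by (rule abelian_group.a_group)
    have "0 \<in> ?K"
      by (simp add: act_kernel_def image_subset_iff)
    then show "?K \<noteq> {}"
      by blast
    show "inv\<^bsub>add_monoid ?R\<^esub> x \<in> ?K" if "x \<in> ?K" for x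
    proof -
      have "inv\<^bsub>add_monoid ?R\<^esub> x = - x"
        using a_inv_free_alg[of x "glb m0 m1 n"] that by (simp add: act_kernel_def a_inv_def)
      then show ?thesis
        using neg[OF that] by simp
    qed
    show "x \<otimes>\<^bsub>add_monoid ?R\<^esub> y \<in> ?K" if "x \<in> ?K" "y \<in> ?K" for x y
      using that by (simp add: act_kernel_def act_add add_stable[OF I] falg_add)
  qed (auto simp: act_kernel_def)
  fix g h assume "g \<in> ?K" "h \<in> carrier ?R"
  then show "h \<otimes>\<^bsub>?R\<^esub> g \<in> ?K" "g \<otimes>\<^bsub>?R\<^esub> h \<in> ?K"
    by (simp_all add: act_kernel_def act_mult falg_mult act_fock_space act_stable[OF I])
qed

lemma raise_defect_stable:
  assumes f: "range f \<subseteq> falg (glb m0 m1 n)"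
    and a: "\<And>i. a = Low i \<Longrightarrow> i \<in> {1..n}" and c: "\<And>i. c = Low i \<Longrightarrow> i \<in> {1..n}"
    and jk: "j \<in> {1..n}" "k \<in> {1..n}"
  shows "range (raise_defect a j c k f) \<subseteq> gli m0 m1 n"
proof (cases "\<exists>i i'. a = Low i \<and> c = Low i'")
  case False
  then have "raise_defect a j c k f = 0"
    by (intro raise_defect_virtual) auto
  then show ?thesis
    by (simp add: image_subset_iff)
next
  case True
  then obtain i i' where ac: "a = Low i" "c = Low i'" by blast
  have "bracket_relation (Low i, Low j) (Low i', Low k) \<in> gli m0 m1 n"
    using a[OF ac(1)] c[OF ac(2)] jk by (intro bracket_relation_in_gli glb_Low_Low)
  also have "bracket_relation (Low i, Low j) (Low i', Low k) =
      letter (Low i, Low j) * letter (Low i', Low k) - letter (Low i', Low k) * letter (Low i, Low j)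
      - free_const (of_bool (i' = j)) * letter (Low i, Low k)
      + free_const (of_bool (i = k)) * letter (Low i', Low j)"
    by (simp add: bracket_relation_def tensor1_elem_bracket elem_parity_def eq_commute[of j])
  finally show ?thesis
    unfolding ac raise_defect_Low using f by (auto intro!: gli_rmult)
qed

lemma act_bracket_relation:
  "act n (bracket_relation (a, b) (c, d)) f =
    rep n (a, b) (rep n (c, d) f)
    - scal ((-1) ^ (elem_parity (a, b) * elem_parity (c, d))) (rep n (c, d) (rep n (a, b) f))
    - scal (of_bool (b = c)) (rep n (a, d) f)
    + scal ((-1) ^ (elem_parity (a, b) * elem_parity (c, d)) * of_bool (a = d)) (rep n (c, b) f)"
  by (simp only: bracket_relation_def act_diff act_sign tensor1_elem_bracket)
    (simp only: act_mult act_letter act_free_const diff_diff_eq2 add.commute diff_add_eq add_diff_eq)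

lemma bracket_relation_in_act_kernel:
  assumes s: "s \<in> glb m0 m1 n" and t: "t \<in> glb m0 m1 n"
  shows "bracket_relation s t \<in> act_kernel m0 m1 n"
proof -
  note I = left_stable_gli[of m0 m1 n]
  obtain a b c d where st: "s = (a, b)" "t = (c, d)"
    by (metis surj_pair)
  have "range (act n (bracket_relation s t) f) \<subseteq> gli m0 m1 n" if "f \<in> fock_space m0 m1 n" for f
  proof -
    have f: "supersym f" "range f \<subseteq> falg (glb m0 m1 n)"
      using that by (auto simp: fock_space_def)
    have a: "i \<in> {1..n}" if "a = Low i" for i
      using s that st glb_Low by blast
    have c: "i \<in> {1..n}" if "c = Low i" for i
      using t that st glb_Low by blast
    have "act n (bracket_relation s t) f = scal (pair_sign b c)
        (\<Sum>j\<in>{1..n}. \<Sum>k\<in>{1..n}. raise_defect a j c k (lower b j (lower d k f)))"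
      unfolding act_bracket_relation st by (rule rep_bracket[OF f(1) a c refl])
    then show ?thesis
      using f(2) by (simp only:) (intro scal_stable[OF I] sum_stable[OF I] raise_defect_stable
          lower_stable[OF left_stable_falg]; (rule a c; assumption)?)
  qed
  then show ?thesis
    using gli_subset[OF bracket_relation_in_gli[OF s t]] by (auto simp: act_kernel_def)
qed

text \<open>The kernel is an ideal, so it is enough that it contains the generators, and these
  reduce to brackets of basis elements.\<close>

lemma gli_subset_act_kernel: "gli m0 m1 n \<subseteq> act_kernel m0 m1 n"
  unfolding env_ideal_def
proof (rule ring.genideal_minimal[OF ring_free_alg ideal_act_kernel], rule subsetI)
  fix r assume "r \<in> env_relations (gl m0 m1 n)"
  then obtain x y p q where r: "r = tensor1 x * tensor1 y - (-1) ^ (p * q) * (tensor1 y * tensor1 x)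
      - tensor1 (lbracket (gl m0 m1 n) x y)"
    and xy: "x \<in> homogeneous (gl m0 m1 n) p" "y \<in> homogeneous (gl m0 m1 n) q"
    unfolding env_relations_def by blast
  note id = ideal_act_kernel[of m0 m1 n]
  have sum: "sum F X \<in> act_kernel m0 m1 n" if "\<And>x. x \<in> X \<Longrightarrow> F x \<in> act_kernel m0 m1 n"
    for X and F :: "sym \<times> sym \<Rightarrow> _"
    using that additive_subgroup.a_closed[OF ideal.axioms(1)[OF id]]
      additive_subgroup.zero_closed[OF ideal.axioms(1)[OF id]]
    by (induction X rule: infinite_finite_induct) simp_all
  have keys: "s \<in> glb m0 m1 n" if "s \<in> Poly_Mapping.keys z" "z \<in> homogeneous (gl m0 m1 n) p" for s z p
    using that by (auto simp: homogeneous_def)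
  show "r \<in> act_kernel m0 m1 n"
    unfolding r env_relation_expand[OF xy]
    using ideal.I_l_closed[OF id bracket_relation_in_act_kernel falg_free_const] keys xy
    by (intro sum) auto
qed

section \<open>Irregular products annihilate the vacuum\<close>

definition vac :: fock where
  "vac = (\<lambda>w. if w = [] then 1 else 0)"

lemma vac_fock_space: "vac \<in> fock_space m0 m1 n"
  by (auto simp: fock_space_def vac_def supersym_def)

text \<open>The weight counts the modes of \<gamma>. It is an integer so that lowering can make it
  negative, which forces the function to vanish.\<close>

definition has_weight :: "sym \<Rightarrow> int \<Rightarrow> fock \<Rightarrow> bool" where
  "has_weight \<gamma> k f \<longleftrightarrow> (\<forall>w. f w \<noteq> 0 \<longrightarrow> int (length (filter (\<lambda>p. fst p = \<gamma>) w)) = k)"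

lemma has_weight_neg: "has_weight \<gamma> k f \<Longrightarrow> k < 0 \<Longrightarrow> f = 0"
  by (force simp: has_weight_def fun_eq_iff)

lemma has_weight_ann: "has_weight \<gamma> k f \<Longrightarrow> has_weight \<gamma> (k - of_bool (fst p = \<gamma>)) (ann p f)"
  by (force simp: has_weight_def ann_def)

lemma has_weight_cre: "has_weight \<gamma> k f \<Longrightarrow> has_weight \<gamma> (k + of_bool (fst p = \<gamma>)) (cre p f)"
  unfolding has_weight_def[of _ _ "cre p f"]
proof (intro allI impI)
  fix w
  assume "has_weight \<gamma> k f" "cre p f w \<noteq> 0"
  then show "int (length (filter (\<lambda>p. fst p = \<gamma>) w)) = k + of_bool (fst p = \<gamma>)"
  proof (induction w arbitrary: f k)
    case (Cons q w)
    show ?case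
    proof (cases "p = q \<and> f w \<noteq> 0")
      case True
      then show ?thesis using Cons.prems(1) by (auto simp: has_weight_def)
    next
      case False
      then have "cre p (ann q f) w \<noteq> 0"
        using Cons.prems(2) by auto
      then show ?thesis
        using Cons.IH[OF has_weight_ann[OF Cons.prems(1), of q]] by auto
    qed
  qed simp
qed

lemma has_weight_subst: "has_weight \<gamma> k f \<Longrightarrow> has_weight \<gamma> k (subst i j f)"
  unfolding has_weight_def[of _ _ "subst i j f"]
proof (intro allI impI)
  fix w
  assume "has_weight \<gamma> k f" "subst i j f w \<noteq> 0"
  then show "int (length (filter (\<lambda>p. fst p = \<gamma>) w)) = k"
  proof (induction w arbitrary: f k)
    case (Cons q w)
    obtain c l where q: "q = (c, l)" by (cases q)
    show ?case
    proof (cases "l = j \<and> f ((c, i) # w) \<noteq> 0")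
      case True
      then show ?thesis using Cons.prems(1) by (force simp: has_weight_def q)
    next
      case False
      then have "subst i j (ann q f) w \<noteq> 0"
        using Cons.prems(2) by (auto simp: q)
      then show ?thesis
        using Cons.IH[OF has_weight_ann[OF Cons.prems(1), of q]] by auto
    qed
  qed simp
qed

lemma has_weight_left_mult: "has_weight \<gamma> k f \<Longrightarrow> has_weight \<gamma> k (\<lambda>w. g * f w)"
  unfolding has_weight_def by (metis mult_zero_right)

lemma has_weight_add: "has_weight \<gamma> k f \<Longrightarrow> has_weight \<gamma> k g \<Longrightarrow> has_weight \<gamma> k (f + g)"
  unfolding has_weight_def plus_fun_apply by (metis add_0)

lemma has_weight_diff: "has_weight \<gamma> k f \<Longrightarrow> has_weight \<gamma> k g \<Longrightarrow> has_weight \<gamma> k (f - g)"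
  unfolding has_weight_def minus_apply by (metis diff_zero)

lemma has_weight_0: "has_weight \<gamma> k 0"
  by (simp add: has_weight_def)

lemma has_weight_sum:
  "(\<And>x. x \<in> X \<Longrightarrow> has_weight \<gamma> k (F x)) \<Longrightarrow> has_weight \<gamma> k (sum F X)"
  by (induction X rule: infinite_finite_induct) (auto intro: has_weight_0 has_weight_add)

lemma has_weight_lower:
  assumes "has_weight \<gamma> k f" "\<And>i. \<gamma> \<noteq> Low i"
  shows "has_weight \<gamma> (k - of_bool (b = \<gamma>)) (lower b j f)"
  using has_weight_ann[OF assms(1), of "(b, j)"] assms
  by (cases b) (auto simp: lower_def scal_def has_weight_def[of _ _ "\<lambda>_. 0"] intro: has_weight_left_mult)

lemma has_weight_raise:
  assumes "has_weight \<gamma> k f" "\<And>i. \<gamma> \<noteq> Low i"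
  shows "has_weight \<gamma> (k + of_bool (a = \<gamma>)) (raise a j f)"
  using has_weight_cre[OF assms(1), of "(a, j)"] assms
  by (cases a) (auto simp: raise_def intro: has_weight_diff has_weight_left_mult has_weight_subst)

lemma has_weight_rep:
  assumes "has_weight \<gamma> k f" "\<And>i. \<gamma> \<noteq> Low i"
  shows "has_weight \<gamma> (k - of_bool (snd s = \<gamma>) + of_bool (fst s = \<gamma>)) (rep n s f)"
  unfolding rep_def by (intro has_weight_sum has_weight_raise has_weight_lower assms)

text \<open>The two counts are those compared in the definition of irregularity.\<close>

lemma has_weight_foldr_rep:
  assumes "\<And>i. \<gamma> \<noteq> Low i"
  shows "has_weight \<gamma> (int (length (filter (\<lambda>s. fst s = \<gamma>) v)) - int (length (filter (\<lambda>s. snd s = \<gamma>) v)))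
    (foldr (rep n) v vac)"
proof (induction v)
  case Nil
  show ?case by (simp add: has_weight_def vac_def)
next
  case (Cons s v)
  show ?case
    using has_weight_rep[OF Cons assms, of s n] by (cases "fst s = \<gamma>"; cases "snd s = \<gamma>") (simp_all add: algebra_simps)
qed

lemma card_index_eq_filter:
  assumes "i \<le> length xs"
  shows "card {j \<in> {1..i}. P (xs ! (j - 1))} = length (filter P (take i xs))"
proof -
  have "{j \<in> {1..i}. P (xs ! (j - 1))} = Suc ` {j. j < length (take i xs) \<and> P (take i xs ! j)}"
    using assms by (auto simp: image_iff Suc_le_eq gr0_conv_Suc)
  then show ?thesis
    by (simp add: card_image length_filter_conv_card)
qed

text \<open>At the factor where the balance of \<gamma> is violated, the lowering operator yields a
  function of negative weight, hence 0.\<close>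

lemma irregular_vac:
  assumes "irregular m0 m1 w"
  shows "foldr (rep n) w vac = 0"
proof -
  obtain i \<gamma> where i: "i \<in> {1..length w}" and \<gamma>: "\<gamma> \<in> A0 m0 \<union> A1 m1"
    and less: "card {j \<in> {1..i}. snd (rev w ! (j - 1)) = \<gamma>} > card {j \<in> {1..<i}. fst (rev w ! (j - 1)) = \<gamma>}"
    using assms unfolding irregular_def by blast
  have nl: "\<gamma> \<noteq> Low i" for i
    using \<gamma> by (auto simp: A0_def A1_def)
  \<comment> \<open>Factors are numbered from the right: \<open>s\<close> is the \<open>i\<close>-th
    one, and \<open>v\<close> consists of the \<open>i - 1\<close> factors acting before it, in
    their order in \<open>w\<close>.\<close>
  define v where "v = rev (take (i - 1) (rev w))"
  define s where "s = rev w ! (i - 1)"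
  have tk: "take i (rev w) = rev v @ [s]"
  proof -
    have "i - 1 < length (rev w)" "Suc (i - 1) = i"
      using i by auto
    then show ?thesis
      using take_Suc_conv_app_nth[of "i - 1" "rev w"] unfolding v_def s_def by simp
  qed
  then have w: "w = rev (drop i (rev w)) @ s # v"
    by (metis append_take_drop_id rev_append rev_rev_ident append_Cons append_Nil rev.simps)
  have 1: "card {j \<in> {1..i}. snd (rev w ! (j - 1)) = \<gamma>} = length (filter (\<lambda>s. snd s = \<gamma>) (s # v))"
    using card_index_eq_filter[of i "rev w" "\<lambda>s. snd s = \<gamma>"] i by (simp add: tk flip: rev_filter)
  have "{1..<i} = {1..i - 1}" "i - 1 \<le> length (rev w)"
    using i by auto
  then have 2: "card {j \<in> {1..<i}. fst (rev w ! (j - 1)) = \<gamma>} = length (filter (\<lambda>s. fst s = \<gamma>) v)"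
    using card_index_eq_filter[of "i - 1" "rev w" "\<lambda>s. fst s = \<gamma>"]
    by (simp add: v_def flip: rev_filter)
  have "length (filter (\<lambda>s. fst s = \<gamma>) v) < length (filter (\<lambda>s. snd s = \<gamma>) (s # v))"
    using less unfolding 1 2 .
  then have "lower (snd s) j (foldr (rep n) v vac) = 0" for j
    by (intro has_weight_neg[OF has_weight_lower[OF has_weight_foldr_rep, of \<gamma>]])
      (use nl in \<open>auto split: if_splits\<close>)
  then have "rep n s (foldr (rep n) v vac) = 0"
    by (simp add: rep_def module_hom.zero[OF lin_raise])
  then show ?thesis
    by (subst w) (simp add: module_hom.zero[OF lin_foldr_rep])
qed

section \<open>Classes in the enveloping algebra and the preimage of \<open>Irr\<close>\<close>

lemma cls_hom: "cls m0 m1 n \<in> ring_hom (free_alg (glb m0 m1 n)) (U m0 m1 n)"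
  using ideal.rcos_ring_hom[OF ideal_gli[of m0 m1 n]]
  by (simp add: env_def env_class_def[abs_def])

lemma cls_closed: "x \<in> falg (glb m0 m1 n) \<Longrightarrow> cls m0 m1 n x \<in> carrier (U m0 m1 n)"
  using ring_hom_closed[OF cls_hom] by blast

lemma cls_add: "x \<in> falg (glb m0 m1 n) \<Longrightarrow> y \<in> falg (glb m0 m1 n) \<Longrightarrow>
    cls m0 m1 n (x + y) = cls m0 m1 n x \<oplus>\<^bsub>U m0 m1 n\<^esub> cls m0 m1 n y"
  using ring_hom_add[OF cls_hom[of m0 m1 n], of x y] by simp

lemma cls_mult: "x \<in> falg (glb m0 m1 n) \<Longrightarrow> y \<in> falg (glb m0 m1 n) \<Longrightarrow>
    cls m0 m1 n (x * y) = cls m0 m1 n x \<otimes>\<^bsub>U m0 m1 n\<^esub> cls m0 m1 n y"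
  using ring_hom_mult[OF cls_hom[of m0 m1 n], of x y] by simp

lemma cls_1: "cls m0 m1 n 1 = \<one>\<^bsub>U m0 m1 n\<^esub>"
  using ring_hom_one[OF cls_hom[of m0 m1 n]] by simp

lemma cls_0: "cls m0 m1 n 0 = \<zero>\<^bsub>U m0 m1 n\<^esub>"
  using ring_hom_zero[OF cls_hom ring_free_alg ring_U] by simp

lemma carrier_U: "carrier (U m0 m1 n) = cls m0 m1 n ` falg (glb m0 m1 n)"
  by (auto simp: env_def FactRing_def A_RCOSETS_def' env_class_def)

lemma cls_conv: "cls m0 m1 n x = (\<lambda>h. h + x) ` gli m0 m1 n"
  by (auto simp: env_class_def a_r_coset_def')

lemma cls_eq_iff: "cls m0 m1 n x = cls m0 m1 n y \<longleftrightarrow> x - y \<in> gli m0 m1 n"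
proof
  assume "cls m0 m1 n x = cls m0 m1 n y"
  moreover have "x \<in> cls m0 m1 n x"
    using gli_0[of m0 m1 n] by (force simp: cls_conv)
  ultimately show "x - y \<in> gli m0 m1 n"
    by (auto simp: cls_conv)
next
  have *: "cls m0 m1 n x \<subseteq> cls m0 m1 n y" if "x - y \<in> gli m0 m1 n" for x y
  proof
    fix z assume "z \<in> cls m0 m1 n x"
    then obtain h where "h \<in> gli m0 m1 n" "z = h + x"
      by (auto simp: cls_conv)
    then have "z = (h + (x - y)) + y" "h + (x - y) \<in> gli m0 m1 n"
      using that by (auto intro: gli_add)
    then show "z \<in> cls m0 m1 n y"
      unfolding cls_conv by blast
  qed
  assume "x - y \<in> gli m0 m1 n"
  then show "cls m0 m1 n x = cls m0 m1 n y"
    using *[of x y] *[of y x] gli_uminus[of "x - y" m0 m1 n] by auto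
qed

abbreviation word :: "'g list \<Rightarrow> 'g free" where
  "word w \<equiv> Poly_Mapping.single (Word w) 1"

lemma word_append: "word (v @ w) = word v * word w"
  by (simp add: mult_single plus_fword_def)

lemma word_Nil: "word [] = 1"
  by (simp add: single_Nil)

lemma falg_word [intro]: "set w \<subseteq> X \<Longrightarrow> word w \<in> falg X"
  by (simp add: falg_single)

lemma e_prod_eq_cls:
  assumes "set w \<subseteq> glb m0 m1 n" shows "e_prod m0 m1 n w = cls m0 m1 n (word w)"
  using assms
proof (induction w)
  case Nil
  show ?case by (simp add: e_prod_def list_prod_def word_Nil cls_1)
next
  case (Cons s w)
  then have "e_prod m0 m1 n (s # w) = env_gen (gl m0 m1 n) s \<otimes>\<^bsub>U m0 m1 n\<^esub> cls m0 m1 n (word w)"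
    by (simp add: e_prod_def list_prod_def)
  also have "\<dots> = cls m0 m1 n (word (s # w))"
    using Cons.prems unfolding single_Cons[of s w] env_gen_def letter_def[symmetric]
    by (subst cls_mult) (auto intro: falg_letter)
  finally show ?case .
qed

lemma additive_subgroup_cls_image:
  assumes "K \<subseteq> falg (glb m0 m1 n)" "0 \<in> K"
    and "\<And>x y. x \<in> K \<Longrightarrow> y \<in> K \<Longrightarrow> x + y \<in> K" "\<And>x. x \<in> K \<Longrightarrow> - x \<in> K"
  shows "additive_subgroup (cls m0 m1 n ` K) (U m0 m1 n)"
proof (rule additive_subgroup.intro, rule group.subgroupI)
  let ?U = "U m0 m1 n"
  interpret U: ring ?U by (rule ring_U)
  show "group (add_monoid ?U)"
    by (rule U.a_group)
  show "cls m0 m1 n ` K \<subseteq> carrier (add_monoid ?U)"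
    using assms(1) cls_closed by auto
  show "cls m0 m1 n ` K \<noteq> {}"
    using assms(2) by blast
  fix a assume "a \<in> cls m0 m1 n ` K"
  then obtain x where x: "x \<in> K" "a = cls m0 m1 n x" by blast
  have "- x \<in> K" using x(1) by (rule assms(4))
  moreover have "\<ominus>\<^bsub>?U\<^esub> a = cls m0 m1 n (- x)"
  proof (rule U.minus_equality)
    have "cls m0 m1 n (- x) \<oplus>\<^bsub>?U\<^esub> a = cls m0 m1 n (- x + x)"
      using x assms(1) calculation by (subst cls_add) auto
    then show "cls m0 m1 n (- x) \<oplus>\<^bsub>?U\<^esub> a = \<zero>\<^bsub>?U\<^esub>"
      by (simp add: cls_0)
  qed (use x assms(1) calculation cls_closed in auto)
  ultimately show "inv\<^bsub>add_monoid ?U\<^esub> a \<in> cls m0 m1 n ` K"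
    by (simp add: a_inv_def)
  fix b assume "b \<in> cls m0 m1 n ` K"
  then obtain y where y: "y \<in> K" "b = cls m0 m1 n y" by blast
  have "a \<oplus>\<^bsub>?U\<^esub> b = cls m0 m1 n (x + y)"
    unfolding x(2) y(2) using x(1) y(1) assms(1) by (subst cls_add) auto
  then show "a \<otimes>\<^bsub>add_monoid ?U\<^esub> b \<in> cls m0 m1 n ` K"
    using assms(3)[OF x(1) y(1)] by simp
qed

lemma left_ideal_Inter:
  assumes "ring R" "\<J> \<noteq> {}" "\<And>J. J \<in> \<J> \<Longrightarrow> left_ideal J R"
  shows "left_ideal (\<Inter>\<J>) R"
proof -
  interpret ring R by fact
  have "subgroup (\<Inter>\<J>) (add_monoid R)"
    using assms(2,3) unfolding left_ideal_def additive_subgroup_def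
    by (intro group.subgroups_Inter a_group) auto
  then show ?thesis
    using assms(3) unfolding left_ideal_def additive_subgroup_def by blast
qed

lemma left_ideal_gen:
  assumes "ring R" "S \<subseteq> carrier R" shows "left_ideal (gen_left_ideal R S) R"
proof -
  interpret ring R by fact
  have "left_ideal (carrier R) R"
    using ideal.axioms(1)[OF oneideal] by (simp add: left_ideal_def)
  then show ?thesis
    unfolding gen_left_ideal_def using assms by (intro left_ideal_Inter) auto
qed

lemma left_ideal_Irr: "left_ideal (Irr m0 m1 n) (U m0 m1 n)"
  unfolding Irr_def by (rule left_ideal_gen[OF ring_U]) (auto simp: e_prod_eq_cls intro!: cls_closed)

text \<open>Pulling \<open>Irr\<close> back to the free algebra allows congruences to be computed
  with ordinary ring operations on representatives.\<close>

definition irr :: "nat \<Rightarrow> nat \<Rightarrow> nat \<Rightarrow> (sym \<times> sym) free set" where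
  "irr m0 m1 n = {g \<in> falg (glb m0 m1 n). cls m0 m1 n g \<in> Irr m0 m1 n}"

lemma irr_subset: "x \<in> irr m0 m1 n \<Longrightarrow> x \<in> falg (glb m0 m1 n)"
  by (simp add: irr_def)

lemma irr_add: "x \<in> irr m0 m1 n \<Longrightarrow> y \<in> irr m0 m1 n \<Longrightarrow> x + y \<in> irr m0 m1 n"
  using left_ideal_Irr[of m0 m1 n] additive_subgroup.a_closed
  by (fastforce simp: irr_def cls_add left_ideal_def)

lemma irr_lmult: "g \<in> falg (glb m0 m1 n) \<Longrightarrow> x \<in> irr m0 m1 n \<Longrightarrow> g * x \<in> irr m0 m1 n"
  using left_ideal_Irr[of m0 m1 n] by (auto simp: irr_def cls_mult left_ideal_def cls_closed)

lemma irr_uminus: "x \<in> irr m0 m1 n \<Longrightarrow> - x \<in> irr m0 m1 n"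
  using irr_lmult[of "- 1" m0 m1 n x] by auto

lemma irr_diff: "x \<in> irr m0 m1 n \<Longrightarrow> y \<in> irr m0 m1 n \<Longrightarrow> x - y \<in> irr m0 m1 n"
  using irr_add[of x m0 m1 n "- y"] irr_uminus by simp

lemma gli_subset_irr: "gli m0 m1 n \<subseteq> irr m0 m1 n"
proof
  fix x assume x: "x \<in> gli m0 m1 n"
  then have "cls m0 m1 n x = cls m0 m1 n 0"
    by (simp add: cls_eq_iff)
  also have "\<dots> \<in> Irr m0 m1 n"
    using left_ideal_Irr[of m0 m1 n] additive_subgroup.zero_closed
    by (fastforce simp: left_ideal_def cls_0)
  finally show "x \<in> irr m0 m1 n"
    using gli_subset[OF x] by (simp add: irr_def)
qed

lemma irr_0 [simp]: "0 \<in> irr m0 m1 n"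
  using gli_subset_irr gli_0 by blast

text \<open>A single factor is irregular at \<open>i = 1\<close>, since no factor before it has
  supplied \<gamma>.\<close>

lemma letter_virtual_irr:
  assumes "(a, \<gamma>) \<in> glb m0 m1 n" "\<gamma> \<in> A0 m0 \<union> A1 m1"
  shows "letter (a, \<gamma>) \<in> irr m0 m1 n"
proof -
  have "{j \<in> {1..(1::nat)}. snd (rev [(a, \<gamma>)] ! (j - 1)) = \<gamma>} = {1}"
    by auto
  then have "irregular m0 m1 [(a, \<gamma>)]"
    unfolding irregular_def using assms(2) by (intro bexI[of _ 1] bexI[of _ \<gamma>]) simp_all
  then have "e_prod m0 m1 n [(a, \<gamma>)] \<in> Irr m0 m1 n"
    unfolding Irr_def gen_left_ideal_def using assms(1) by fastforce
  moreover have "e_prod m0 m1 n [(a, \<gamma>)] = cls m0 m1 n (letter (a, \<gamma>))"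
    using assms(1) by (simp add: e_prod_eq_cls letter_def)
  ultimately show ?thesis
    using assms(1) by (auto simp: irr_def)
qed

text \<open>The classes that have a representative killing the vacuum modulo \<open>gli\<close> form
  a left ideal, and by \<open>irregular_vac\<close> it contains the generators of
  \<open>Irr\<close>.\<close>

lemma Irr_vac:
  assumes "X \<in> Irr m0 m1 n"
  shows "\<exists>g \<in> falg (glb m0 m1 n). X = cls m0 m1 n g \<and> range (act n g vac) \<subseteq> gli m0 m1 n"
proof -
  let ?K = "{g \<in> falg (glb m0 m1 n). range (act n g vac) \<subseteq> gli m0 m1 n}"
  note I = left_stable_gli[of m0 m1 n]
  have "additive_subgroup (cls m0 m1 n ` ?K) (U m0 m1 n)"
  proof (rule additive_subgroup_cls_image)
    fix x assume x: "x \<in> ?K"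
    show "- x \<in> ?K"
      using x scal_stable[OF I, of "act n x vac" "-1"] by (simp add: act_uminus falg_uminus)
    fix y assume "y \<in> ?K"
    then show "x + y \<in> ?K"
      using x by (simp add: act_add falg_add add_stable[OF I])
  qed (auto simp: zero_stable[OF I])
  moreover have "x \<otimes>\<^bsub>U m0 m1 n\<^esub> a \<in> cls m0 m1 n ` ?K"
    if "x \<in> carrier (U m0 m1 n)" "a \<in> cls m0 m1 n ` ?K" for x a
  proof -
    obtain g h where gh: "g \<in> falg (glb m0 m1 n)" "x = cls m0 m1 n g" "h \<in> ?K" "a = cls m0 m1 n h"
      using \<open>x \<in> _\<close> \<open>a \<in> _\<close> unfolding carrier_U by blast
    then have "g * h \<in> ?K"
      by (simp add: act_mult falg_mult act_stable[OF I])
    moreover have "x \<otimes>\<^bsub>U m0 m1 n\<^esub> a = cls m0 m1 n (g * h)"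
      using gh by (simp add: cls_mult)
    ultimately show ?thesis
      by blast
  qed
  ultimately have "left_ideal (cls m0 m1 n ` ?K) (U m0 m1 n)"
    by (simp add: left_ideal_def)
  moreover have "e_prod m0 m1 n w \<in> cls m0 m1 n ` ?K"
    if "set w \<subseteq> glb m0 m1 n" "irregular m0 m1 w" for w
  proof -
    have "range (act n (word w) vac) \<subseteq> gli m0 m1 n"
      using irregular_vac[OF that(2)] by (simp add: act_single zero_stable[OF I])
    then show ?thesis
      using that(1) by (simp add: e_prod_eq_cls falg_word)
  qed
  ultimately have "Irr m0 m1 n \<subseteq> cls m0 m1 n ` ?K"
    unfolding Irr_def gen_left_ideal_def by blast
  then show ?thesis
    using assms by blast
qed

section \<open>The projection is well defined\<close>

lemma fock_sum_apply: "(\<Sum>x\<in>X. F x) w = (\<Sum>x\<in>X. (F x :: fock) w)"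
  by (induction X rule: infinite_finite_induct) (simp_all add: plus_fun_apply)

text \<open>\<open>subst\<close> vanishes at the empty word, so there each letter acts by
  multiplication of the value alone and the word is rebuilt letter by letter.\<close>

lemma act_vac_Low:
  assumes "g \<in> falg (L n \<times> L n)"
  shows "act n g vac [] = g"
proof -
  have 1: "foldr (rep n) v vac [] = word v" if "set v \<subseteq> L n \<times> L n" for v
    using that
  proof (induction v)
    case Nil
    show ?case by (simp add: vac_def word_Nil)
  next
    case (Cons s v)
    obtain i j where s: "s = (Low i, Low j)" "j \<in> {1..n}"
      using Cons.prems by (auto simp: L_def)
    let ?f = "foldr (rep n) v vac"
    have "rep n s ?f [] = (\<Sum>l\<in>{1..n}. free_const (of_bool (l = j)) * letter (Low i, Low l) * ?f [])"
      by (simp add: rep_def s raise_def lower_def scal_apply minus_apply fock_sum_apply free_const_left_commute mult.assoc eq_commute[of j])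
    also have "\<dots> = letter s * ?f []"
      using s by (simp add: of_bool_def if_distrib[of free_const] if_distrib[of "\<lambda>c. c * _"] cong: if_cong)
    finally show ?case
      using Cons by (simp add: single_Cons)
  qed
  have "act n g vac [] = (\<Sum>v\<in>Poly_Mapping.keys g.
      free_const (Poly_Mapping.lookup g v) * foldr (rep n) (letters v) vac [])"
    by (simp add: act_def fock_sum_apply scal_apply)
  also have "\<dots> = (\<Sum>v\<in>Poly_Mapping.keys g. Poly_Mapping.single v (Poly_Mapping.lookup g v))"
    using assms by (intro sum.cong) (auto simp: free_alg_def 1 mult_single free_const_def)
  finally show ?thesis
    by (simp add: sum_single)
qed

lemma Low_subset_glb: "L n \<times> L n \<subseteq> glb m0 m1 n"
  by (auto simp: gl_def)

text \<open>Directness of the sum. The class of \<open>u\<close> has a representative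
  \<open>g\<close> killing the vacuum modulo \<open>gli\<close>; since \<open>u - g\<close> acts
  trivially modulo \<open>gli\<close>, so does \<open>u\<close> on the vacuum, and its value at the
  empty word is \<open>u\<close> itself.\<close>

lemma Ugl_irr_trivial:
  assumes "u \<in> falg (L n \<times> L n)" "u \<in> irr m0 m1 n"
  shows "u \<in> gli m0 m1 n"
proof -
  obtain g where g: "g \<in> falg (glb m0 m1 n)" "cls m0 m1 n u = cls m0 m1 n g"
    "range (act n g vac) \<subseteq> gli m0 m1 n"
    using assms(2) Irr_vac[of "cls m0 m1 n u" m0 m1 n] by (auto simp: irr_def)
  have "u - g \<in> act_kernel m0 m1 n"
    using g(2) gli_subset_act_kernel by (auto simp: cls_eq_iff)
  then have "range (act n (u - g) vac) \<subseteq> gli m0 m1 n"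
    using vac_fock_space by (simp add: act_kernel_def)
  then have "act n (u - g) vac [] + act n g vac [] \<in> gli m0 m1 n"
    using g(3) by (intro gli_add) auto
  then show ?thesis
    by (simp add: act_diff minus_apply act_vac_Low[OF assms(1)])
qed

text \<open>The way every projection is evaluated below: a congruence with an element of U(gl(n))
  yields both membership in \<open>Virt\<close> and the value.\<close>

lemma virt_proj_cls:
  assumes x: "x \<in> falg (glb m0 m1 n)" and u: "u \<in> falg (L n \<times> L n)" and xu: "x - u \<in> irr m0 m1 n"
  shows "virt_proj m0 m1 n (cls m0 m1 n x) = cls m0 m1 n u"
proof -
  have Lg: "v \<in> falg (glb m0 m1 n)" if "v \<in> falg (L n \<times> L n)" for v
    using that falg_mono[OF Low_subset_glb] by blast
  have "x - u \<in> falg (glb m0 m1 n)"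
    using xu by (rule irr_subset)
  then have sum: "cls m0 m1 n x = cls m0 m1 n u \<oplus>\<^bsub>U m0 m1 n\<^esub> cls m0 m1 n (x - u)"
    using cls_add[OF Lg[OF u], of "x - u"] by simp
  have ex: "cls m0 m1 n u \<in> Ugl m0 m1 n" "cls m0 m1 n (x - u) \<in> Irr m0 m1 n"
    using u xu by (simp_all add: Ugl_def irr_def)
  have virt: "cls m0 m1 n x \<in> Virt m0 m1 n"
    unfolding Virt_def set_add_def' sum by (intro UN_I[OF ex(1)] UN_I[OF ex(2)] singletonI)
  have uniq: "v = cls m0 m1 n u" if v: "v \<in> Ugl m0 m1 n" and r: "r \<in> Irr m0 m1 n"
    and vr: "cls m0 m1 n x = v \<oplus>\<^bsub>U m0 m1 n\<^esub> r" for v r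
  proof -
    obtain u' where u': "u' \<in> falg (L n \<times> L n)" "v = cls m0 m1 n u'"
      using v unfolding Ugl_def by blast
    obtain r' where r': "r' \<in> falg (glb m0 m1 n)" "r = cls m0 m1 n r'"
      using Irr_vac[OF r] by blast
    have "cls m0 m1 n x = cls m0 m1 n (u' + r')"
      using cls_add[OF Lg[OF u'(1)] r'(1)] vr u'(2) r'(2) by (simp only:)
    then have "x - (u' + r') \<in> irr m0 m1 n"
      using gli_subset_irr unfolding cls_eq_iff by blast
    moreover have "r' \<in> irr m0 m1 n"
      using r r' by (simp add: irr_def)
    ultimately have "(x - (u' + r')) + r' - (x - u) \<in> irr m0 m1 n"
      using xu by (simp only: irr_diff irr_add)
    \<comment> \<open>The difference of two decompositions lies both in U(gl(n)) and in
      \<open>irr\<close>, so \<open>Ugl_irr_trivial\<close> applies.\<close>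
    moreover have "(x - (u' + r')) + r' - (x - u) = u - u'"
      by simp
    ultimately have "u - u' \<in> gli m0 m1 n"
      using falg_diff[OF u u'(1)] by (simp only: Ugl_irr_trivial)
    then have "u' - u \<in> gli m0 m1 n"
      using gli_uminus[of "u - u'" m0 m1 n] by simp
    then show ?thesis
      by (simp add: u' cls_eq_iff)
  qed
  have "(THE v. v \<in> Ugl m0 m1 n \<and> (\<exists>r \<in> Irr m0 m1 n. cls m0 m1 n x = v \<oplus>\<^bsub>U m0 m1 n\<^esub> r)) =
      cls m0 m1 n u"
  proof (rule the_equality)
    show "cls m0 m1 n u \<in> Ugl m0 m1 n \<and>
        (\<exists>r \<in> Irr m0 m1 n. cls m0 m1 n x = cls m0 m1 n u \<oplus>\<^bsub>U m0 m1 n\<^esub> r)"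
      using ex(1) by (intro conjI bexI[OF _ ex(2)] sum)
  next
    fix v assume "v \<in> Ugl m0 m1 n \<and> (\<exists>r \<in> Irr m0 m1 n. cls m0 m1 n x = v \<oplus>\<^bsub>U m0 m1 n\<^esub> r)"
    then show "v = cls m0 m1 n u"
      using uniq by (elim conjE bexE)
  qed
  then show ?thesis
    unfolding virt_proj_def restrict_apply using virt by (simp only: if_True)
qed

section \<open>Congruences modulo \<open>Irr\<close>\<close>

definition irr_cong :: "nat \<Rightarrow> nat \<Rightarrow> nat \<Rightarrow> (sym \<times> sym) free \<Rightarrow> (sym \<times> sym) free \<Rightarrow> bool" where
  "irr_cong m0 m1 n x y \<longleftrightarrow> x - y \<in> irr m0 m1 n"

lemma irr_cong_refl [simp]: "irr_cong m0 m1 n x x"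
  by (simp add: irr_cong_def)

lemma irr_cong_trans [trans]:
  "irr_cong m0 m1 n x y \<Longrightarrow> irr_cong m0 m1 n y z \<Longrightarrow> irr_cong m0 m1 n x z"
  using irr_add[of "x - y" m0 m1 n "y - z"] by (simp add: irr_cong_def)

lemma irr_cong_add:
  "irr_cong m0 m1 n x y \<Longrightarrow> irr_cong m0 m1 n x' y' \<Longrightarrow> irr_cong m0 m1 n (x + x') (y + y')"
  using irr_add[of "x - y" m0 m1 n "x' - y'"] by (simp add: irr_cong_def algebra_simps)

lemma irr_cong_uminus: "irr_cong m0 m1 n x y \<Longrightarrow> irr_cong m0 m1 n (- x) (- y)"
  using irr_uminus[of "x - y" m0 m1 n] by (simp add: irr_cong_def algebra_simps)

lemma irr_cong_lmult:
  "g \<in> falg (glb m0 m1 n) \<Longrightarrow> irr_cong m0 m1 n x y \<Longrightarrow> irr_cong m0 m1 n (g * x) (g * y)"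
  using irr_lmult[of g m0 m1 n "x - y"] by (simp add: irr_cong_def algebra_simps)

lemma irr_cong_0: "irr_cong m0 m1 n x 0 \<longleftrightarrow> x \<in> irr m0 m1 n"
  by (simp add: irr_cong_def)

abbreviation e :: "sym \<Rightarrow> sym \<Rightarrow> (sym \<times> sym) free" where
  "e a b \<equiv> letter (a, b)"

text \<open>Since \<open>Irr\<close> is a left ideal, congruences are multiplied on the left only.
  The bracket relation itself lies in the two-sided ideal \<open>gli\<close>, so an arbitrary tail
  \<open>z\<close> may follow it; all later exchanges take place in front of such a tail.\<close>

lemma irr_cong_swap:
  assumes "(a, b) \<in> glb m0 m1 n" "(c, d) \<in> glb m0 m1 n" "z \<in> falg (glb m0 m1 n)"
    and s: "s = (-1) ^ (elem_parity (a, b) * elem_parity (c, d))"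
  shows "irr_cong m0 m1 n (e a b * (e c d * z))
    (s * (e c d * (e a b * z)) + (of_bool (b = c) * (e a d * z) - s * of_bool (a = d) * (e c b * z)))"
proof -
  have "bracket_relation (a, b) (c, d) * z \<in> irr m0 m1 n"
    using gli_rmult[OF bracket_relation_in_gli[OF assms(1,2)] assms(3)] gli_subset_irr by blast
  moreover have "free_const (of_bool P) = of_bool P" for P
    by (cases P) simp_all
  then have "bracket_relation (a, b) (c, d) * z = e a b * (e c d * z) -
    (s * (e c d * (e a b * z)) + (of_bool (b = c) * (e a d * z) - s * of_bool (a = d) * (e c b * z)))"
    by (simp add: bracket_relation_def tensor1_elem_bracket s free_const_sign algebra_simps
        flip: free_const_mult)
  ultimately show ?thesis
    by (simp add: irr_cong_def)
qed

definition raising :: "sym \<Rightarrow> nat list \<Rightarrow> (sym \<times> sym) free" where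
  "raising \<alpha> js = word (map (\<lambda>j. (\<alpha>, Low j)) js)"

lemma raising_Nil [simp]: "raising \<alpha> [] = 1"
  by (simp add: raising_def word_Nil)

lemma raising_Cons [simp]: "raising \<alpha> (j # js) = e \<alpha> (Low j) * raising \<alpha> js"
  by (simp add: raising_def single_Cons)

definition virt :: "nat \<Rightarrow> nat \<Rightarrow> sym set" where
  "virt m0 m1 = A0 m0 \<union> A1 m1"

lemma virt_neq_Low: "\<gamma> \<in> virt m0 m1 \<Longrightarrow> \<gamma> \<noteq> Low i" "\<gamma> \<in> virt m0 m1 \<Longrightarrow> Low i \<noteq> \<gamma>"
  by (auto simp: virt_def A0_def A1_def)

lemma glb_virt:
  "a \<in> virt m0 m1 \<Longrightarrow> b \<in> virt m0 m1 \<Longrightarrow> (a, b) \<in> glb m0 m1 n"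
  "a \<in> virt m0 m1 \<Longrightarrow> j \<in> {1..n} \<Longrightarrow> (a, Low j) \<in> glb m0 m1 n"
  "i \<in> {1..n} \<Longrightarrow> b \<in> virt m0 m1 \<Longrightarrow> (Low i, b) \<in> glb m0 m1 n"
  by (auto simp: virt_def gl_def L_def)

lemma A0_virt: "\<alpha> \<in> A0 m0 \<Longrightarrow> \<alpha> \<in> virt m0 m1"
  by (simp add: virt_def)

lemma raising_falg: "\<alpha> \<in> virt m0 m1 \<Longrightarrow> set js \<subseteq> {1..n} \<Longrightarrow> raising \<alpha> js \<in> falg (glb m0 m1 n)"
  unfolding raising_def by (intro falg_word) (auto simp: glb_virt)

lemma letter_irr: "(a, \<gamma>) \<in> glb m0 m1 n \<Longrightarrow> \<gamma> \<in> virt m0 m1 \<Longrightarrow> e a \<gamma> \<in> irr m0 m1 n"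
  unfolding virt_def by (rule letter_virtual_irr)

text \<open>Passing each factor \<open>e \<alpha> (Low j)\<close> contributes one copy of the
  product, and \<open>e \<alpha> \<alpha>\<close> at the right end lies in
  \<open>irr\<close>.\<close>

lemma raising_weight:
  assumes "\<alpha> \<in> A0 m0" "set js \<subseteq> {1..n}"
  shows "irr_cong m0 m1 n (e \<alpha> \<alpha> * raising \<alpha> js) (of_nat (length js) * raising \<alpha> js)"
  using assms(2)
proof (induction js)
  case Nil
  show ?case
    using letter_irr[OF glb_virt(1)] A0_virt[OF assms(1), of m1] by (simp add: irr_cong_0)
next
  case (Cons j js)
  have v: "\<alpha> \<in> virt m0 m1" and j: "j \<in> {1..n}" "set js \<subseteq> {1..n}"
    using assms(1) Cons.prems by (auto simp: A0_virt)
  have "elem_parity (\<alpha>, \<alpha>) = 0"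
    by (auto simp: elem_parity_def)
  then have "irr_cong m0 m1 n (e \<alpha> \<alpha> * raising \<alpha> (j # js))
      (e \<alpha> (Low j) * (e \<alpha> \<alpha> * raising \<alpha> js) + e \<alpha> (Low j) * raising \<alpha> js)"
    using irr_cong_swap[OF glb_virt(1)[OF v v] glb_virt(2)[OF v j(1)] raising_falg[OF v j(2)] refl]
    by (simp add: virt_neq_Low[OF v])
  also have "irr_cong m0 m1 n \<dots>
      (e \<alpha> (Low j) * (of_nat (length js) * raising \<alpha> js) + e \<alpha> (Low j) * raising \<alpha> js)"
    using Cons.IH[OF j(2)] v j(1)
    by (intro irr_cong_add irr_cong_lmult falg_letter glb_virt irr_cong_refl)
  also have "\<dots> = of_nat (length (j # js)) * raising \<alpha> (j # js)"
    using mult_of_nat_commute[of "length js" "e \<alpha> (Low j)"]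
    by (simp add: algebra_simps flip: mult.assoc)
  finally show ?case .
qed

text \<open>Both indices of \<open>e a \<gamma>\<close> avoid the matching indices of the factors,
  so it passes them up to sign and ends in \<open>irr\<close>.\<close>

lemma virtual_raising:
  assumes v: "\<alpha> \<in> virt m0 m1" "a \<in> virt m0 m1" "\<gamma> \<in> virt m0 m1" "\<gamma> \<noteq> \<alpha>" and "set js \<subseteq> {1..n}"
  shows "irr_cong m0 m1 n (e a \<gamma> * raising \<alpha> js) 0"
  using assms(5)
proof (induction js)
  case Nil
  show ?case
    using letter_irr[OF glb_virt(1)] v by (simp add: irr_cong_0)
next
  case (Cons j js)
  have j: "j \<in> {1..n}" "set js \<subseteq> {1..n}"
    using Cons.prems by auto
  define s where "s = (-1 :: (sym \<times> sym) free) ^ (elem_parity (a, \<gamma>) * elem_parity (\<alpha>, Low j))"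
  have "irr_cong m0 m1 n (e a \<gamma> * raising \<alpha> (j # js)) (s * e \<alpha> (Low j) * (e a \<gamma> * raising \<alpha> js))"
    using irr_cong_swap[OF glb_virt(1)[OF v(2,3)] glb_virt(2)[OF v(1) j(1)] raising_falg[OF v(1) j(2)] s_def]
    by (simp add: virt_neq_Low[OF v(2)] v(4) mult.assoc)
  also have "irr_cong m0 m1 n \<dots> (s * e \<alpha> (Low j) * 0)"
    unfolding s_def
    using Cons.IH[OF j(2)] v(1) j(1) by (intro irr_cong_lmult falg_sign falg_letter glb_virt)
  finally show ?case by simp
qed

section \<open>Removing the virtual symbol\<close>

text \<open>Families, indexed by the virtual symbol \<open>\<alpha>\<close>, that modulo \<open>Irr\<close> are combinations, with
  coefficients in \<open>U(gl(n))\<close> not depending on \<open>\<alpha>\<close>, of products of \<open>k\<close> factors \<open>e\<^bsub>\<alpha>,j\<^esub>\<close>.\<close>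

inductive raising_span :: "nat \<Rightarrow> nat \<Rightarrow> nat \<Rightarrow> nat \<Rightarrow> (sym \<Rightarrow> (sym \<times> sym) free) \<Rightarrow> bool"
  for m0 m1 n where
  raising: "set js \<subseteq> {1..n} \<Longrightarrow> raising_span m0 m1 n (length js) (\<lambda>\<alpha>. raising \<alpha> js)"
| zero: "raising_span m0 m1 n k (\<lambda>_. 0)"
| add: "raising_span m0 m1 n k \<phi> \<Longrightarrow> raising_span m0 m1 n k \<psi> \<Longrightarrow>
    raising_span m0 m1 n k (\<lambda>\<alpha>. \<phi> \<alpha> + \<psi> \<alpha>)"
| scale: "raising_span m0 m1 n k \<phi> \<Longrightarrow> raising_span m0 m1 n k (\<lambda>\<alpha>. free_const c * \<phi> \<alpha>)"
| gl: "i \<in> {1..n} \<Longrightarrow> l \<in> {1..n} \<Longrightarrow> raising_span m0 m1 n k \<phi> \<Longrightarrow>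
    raising_span m0 m1 n k (\<lambda>\<alpha>. e (Low i) (Low l) * \<phi> \<alpha>)"
| cong: "raising_span m0 m1 n k \<phi> \<Longrightarrow> (\<And>\<alpha>. \<alpha> \<in> A0 m0 \<Longrightarrow> irr_cong m0 m1 n (\<psi> \<alpha>) (\<phi> \<alpha>)) \<Longrightarrow>
    raising_span m0 m1 n k \<psi>"

lemma raising_span_falg:
  "raising_span m0 m1 n k \<phi> \<Longrightarrow> \<alpha> \<in> A0 m0 \<Longrightarrow> \<phi> \<alpha> \<in> falg (glb m0 m1 n)"
proof (induction rule: raising_span.induct)
  case (raising js)
  then show ?case by (intro raising_falg A0_virt)
next
  case (gl i l k \<phi>)
  then show ?case by (intro falg_mult falg_letter glb_Low_Low)
next
  case (cong k \<phi> \<psi>)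
  then have "\<psi> \<alpha> - \<phi> \<alpha> \<in> falg (glb m0 m1 n)"
    by (intro irr_subset) (simp add: irr_cong_def)
  then have "(\<psi> \<alpha> - \<phi> \<alpha>) + \<phi> \<alpha> \<in> falg (glb m0 m1 n)"
    using cong by (intro falg_add)
  then show ?case by simp
qed auto

lemma elem_parity_Low_Low [simp]: "elem_parity (Low i, Low j) = 0"
  by (simp add: elem_parity_def)

text \<open>The case \<open>gl\<close> is the one with content: passing a letter of gl(n) costs a
  bracket that is again a raising letter, with coefficient independent of \<alpha>.\<close>

lemma raising_span_raise:
  "raising_span m0 m1 n k \<phi> \<Longrightarrow> j \<in> {1..n} \<Longrightarrow>
    raising_span m0 m1 n (Suc k) (\<lambda>\<alpha>. e \<alpha> (Low j) * \<phi> \<alpha>)"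
proof (induction arbitrary: j rule: raising_span.induct)
  case (raising js)
  then show ?case
    using raising_span.raising[of "j # js" n m0 m1] by simp
next
  case (zero k)
  show ?case by (simp add: raising_span.zero)
next
  case (add k \<phi> \<psi>)
  then show ?case by (simp add: distrib_left raising_span.add)
next
  case (scale k \<phi> c)
  then show ?case by (simp add: raising_span.scale flip: free_const_left_commute)
next
  case (gl i l k \<phi>)
  show ?case
  proof (rule raising_span.cong)
    show "raising_span m0 m1 n (Suc k) (\<lambda>\<alpha>. e (Low i) (Low l) * (e \<alpha> (Low j) * \<phi> \<alpha>) +
        free_const (of_bool (j = i)) * (e \<alpha> (Low l) * \<phi> \<alpha>))"
      using gl by (intro raising_span.add raising_span.gl raising_span.scale)
    fix \<alpha> assume \<alpha>: "\<alpha> \<in> A0 m0"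
    then have v: "\<alpha> \<in> virt m0 m1" by (rule A0_virt)
    show "irr_cong m0 m1 n (e \<alpha> (Low j) * (e (Low i) (Low l) * \<phi> \<alpha>))
       (e (Low i) (Low l) * (e \<alpha> (Low j) * \<phi> \<alpha>) + free_const (of_bool (j = i)) * (e \<alpha> (Low l) * \<phi> \<alpha>))"
      using irr_cong_swap[OF glb_virt(2)[OF v gl.prems] glb_Low_Low[OF gl.hyps(1,2)]
          raising_span_falg[OF gl.hyps(3) \<alpha>] refl]
      by (cases "j = i") (simp_all add: virt_neq_Low[OF v])
  qed
next
  case (cong k \<phi> \<psi>)
  then show ?case
    by (intro raising_span.cong[OF cong.IH[OF cong.prems]] irr_cong_lmult falg_letter glb_virt A0_virt)
qed

text \<open>Passing \<open>e \<alpha> (Low j)\<close> yields a sign, the letter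
  \<open>e (Low i) (Low j)\<close> and, if \<open>i = j\<close>, \<open>e \<alpha> \<alpha>\<close>,
  which acts as the number of remaining factors. None of these coefficients depends on
  \<alpha>.\<close>

lemma raising_span_lower_raising:
  assumes "i \<in> {1..n}" "set js \<subseteq> {1..n}"
  shows "raising_span m0 m1 n (length js - 1) (\<lambda>\<alpha>. e (Low i) \<alpha> * raising \<alpha> js)"
  using assms(2)
proof (induction js)
  case Nil
  show ?case
    by (rule raising_span.cong[OF raising_span.zero])
      (use assms(1) in \<open>auto simp: irr_cong_0 intro!: letter_irr glb_virt A0_virt simp del: atLeastAtMost_iff\<close>)
next
  case (Cons j js)
  then have j: "j \<in> {1..n}" "set js \<subseteq> {1..n}" by auto
  let ?b = "free_const (of_bool (i = j))" and ?l = "free_const (of_nat (length js))"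
  have "raising_span m0 m1 n (length js) (\<lambda>\<alpha>. e \<alpha> (Low j) * (e (Low i) \<alpha> * raising \<alpha> js))"
  proof (cases js)
    \<comment> \<open>The degree \<open>length js - 1\<close> of the induction hypothesis is
      truncated for the empty list, but there \<open>e (Low i) \<alpha>\<close> alone is already in
      \<open>irr\<close>.\<close>
    case Nil
    show ?thesis
      unfolding Nil
      by (rule raising_span.cong[OF raising_span.zero])
        (use assms(1) j in \<open>auto simp: irr_cong_0 intro!: irr_lmult falg_letter letter_irr glb_virt A0_virt simp del: atLeastAtMost_iff\<close>)
  next
    case (Cons j' js')
    then show ?thesis
      using raising_span_raise[OF Cons.IH[OF j(2)] j(1)] by simp
  qed
  then have "raising_span m0 m1 n (length js)
      (\<lambda>\<alpha>. (free_const (-1) * (e \<alpha> (Low j) * (e (Low i) \<alpha> * raising \<alpha> js)) +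
        e (Low i) (Low j) * raising \<alpha> js) + ?b * (?l * raising \<alpha> js))"
    using assms(1) j by (intro raising_span.add raising_span.scale raising_span.gl raising_span.raising)
  then have "raising_span m0 m1 n (length js) (\<lambda>\<alpha>. e (Low i) \<alpha> * raising \<alpha> (j # js))"
  proof (rule raising_span.cong)
    fix \<alpha> assume \<alpha>: "\<alpha> \<in> A0 m0"
    then have v: "\<alpha> \<in> virt m0 m1" by (rule A0_virt)
    have p: "elem_parity (Low i, \<alpha>) = 1" "elem_parity (\<alpha>, Low j) = 1" for i j
      using \<alpha> by (auto simp: A0_def elem_parity_def)
    have "irr_cong m0 m1 n (e (Low i) \<alpha> * raising \<alpha> (j # js))
        ((free_const (-1) * (e \<alpha> (Low j) * (e (Low i) \<alpha> * raising \<alpha> js)) +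
        e (Low i) (Low j) * raising \<alpha> js) + ?b * (e \<alpha> \<alpha> * raising \<alpha> js))"
      using irr_cong_swap[OF glb_virt(3)[OF assms(1) v] glb_virt(2)[OF v j(1)] raising_falg[OF v j(2)] refl]
      by (cases "i = j") (simp_all add: p free_const_minus algebra_simps)
    also have "irr_cong m0 m1 n \<dots>
        ((free_const (-1) * (e \<alpha> (Low j) * (e (Low i) \<alpha> * raising \<alpha> js)) +
        e (Low i) (Low j) * raising \<alpha> js) + ?b * (?l * raising \<alpha> js))"
      unfolding free_const_of_nat
      using raising_weight[OF \<alpha> j(2)] by (intro irr_cong_add irr_cong_lmult falg_free_const irr_cong_refl)
    finally show "irr_cong m0 m1 n (e (Low i) \<alpha> * raising \<alpha> (j # js)) \<dots>" .
  qed
  then show ?case by simp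
qed

lemma raising_span_lower:
  "raising_span m0 m1 n k \<phi> \<Longrightarrow> i \<in> {1..n} \<Longrightarrow>
    raising_span m0 m1 n (k - 1) (\<lambda>\<alpha>. e (Low i) \<alpha> * \<phi> \<alpha>)"
proof (induction arbitrary: i rule: raising_span.induct)
  case (raising js)
  then show ?case by (intro raising_span_lower_raising)
next
  case (zero k)
  show ?case by (simp add: raising_span.zero)
next
  case (add k \<phi> \<psi>)
  then show ?case by (simp add: distrib_left raising_span.add)
next
  case (scale k \<phi> c)
  then show ?case by (simp add: raising_span.scale flip: free_const_left_commute)
next
  case (gl i' l k \<phi>)
  show ?case
  proof (rule raising_span.cong)
    show "raising_span m0 m1 n (k - 1) (\<lambda>\<alpha>. e (Low i') (Low l) * (e (Low i) \<alpha> * \<phi> \<alpha>) +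
        free_const (- of_bool (i = l)) * (e (Low i') \<alpha> * \<phi> \<alpha>))"
      using gl by (intro raising_span.add raising_span.gl raising_span.scale)
    fix \<alpha> assume \<alpha>: "\<alpha> \<in> A0 m0"
    then have v: "\<alpha> \<in> virt m0 m1" by (rule A0_virt)
    show "irr_cong m0 m1 n (e (Low i) \<alpha> * (e (Low i') (Low l) * \<phi> \<alpha>))
       (e (Low i') (Low l) * (e (Low i) \<alpha> * \<phi> \<alpha>) + free_const (- of_bool (i = l)) * (e (Low i') \<alpha> * \<phi> \<alpha>))"
      using irr_cong_swap[OF glb_virt(3)[OF gl.prems v] glb_Low_Low[OF gl.hyps(1,2)]
          raising_span_falg[OF gl.hyps(3) \<alpha>] refl]
      by (cases "i = l") (simp_all add: virt_neq_Low[OF v] free_const_minus)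
  qed
next
  case (cong k \<phi> \<psi>)
  then show ?case
    by (intro raising_span.cong[OF cong.IH[OF cong.prems]] irr_cong_lmult falg_letter glb_virt A0_virt)
qed

text \<open>The order of quantifiers matters: one \<open>u\<close> serves all \<alpha>, so different
  symbols may be used in the two central elements.\<close>

lemma raising_span_0:
  "raising_span m0 m1 n k \<phi> \<Longrightarrow> k = 0 \<Longrightarrow>
    \<exists>u \<in> falg (L n \<times> L n). \<forall>\<alpha> \<in> A0 m0. irr_cong m0 m1 n (\<phi> \<alpha>) u"
proof (induction rule: raising_span.induct)
  case (raising js)
  then show ?case by (intro bexI[of _ 1]) auto
next
  case (zero k)
  show ?case by (intro bexI[of _ 0]) auto
next
  case (add k \<phi> \<psi>)
  then obtain u v where "u \<in> falg (L n \<times> L n)" "v \<in> falg (L n \<times> L n)"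
    "\<forall>\<alpha> \<in> A0 m0. irr_cong m0 m1 n (\<phi> \<alpha>) u" "\<forall>\<alpha> \<in> A0 m0. irr_cong m0 m1 n (\<psi> \<alpha>) v"
    by blast
  then show ?case by (intro bexI[of _ "u + v"]) (auto intro: irr_cong_add)
next
  case (scale k \<phi> c)
  then obtain u where "u \<in> falg (L n \<times> L n)" "\<forall>\<alpha> \<in> A0 m0. irr_cong m0 m1 n (\<phi> \<alpha>) u"
    by blast
  then show ?case
    by (intro bexI[of _ "free_const c * u"]) (auto intro!: irr_cong_lmult)
next
  case (gl i l k \<phi>)
  then obtain u where "u \<in> falg (L n \<times> L n)" "\<forall>\<alpha> \<in> A0 m0. irr_cong m0 m1 n (\<phi> \<alpha>) u"
    by blast
  moreover have "(Low i, Low l) \<in> glb m0 m1 n" "(Low i, Low l) \<in> L n \<times> L n"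
    using gl.hyps by (auto simp: L_def gl_def)
  ultimately show ?case
    by (intro bexI[of _ "e (Low i) (Low l) * u"]) (auto intro!: irr_cong_lmult)
next
  case (cong k \<phi> \<psi>)
  then show ?case by (meson irr_cong_trans)
qed

lemma raising_span_lowering:
  assumes "set is \<subseteq> {1..n}" "set js \<subseteq> {1..n}"
  shows "raising_span m0 m1 n (length js - length is)
    (\<lambda>\<alpha>. word (map (\<lambda>i. (Low i, \<alpha>)) is) * raising \<alpha> js)"
  using assms(1)
proof (induction "is")
  case Nil
  show ?case
    using raising_span.raising[OF assms(2)] by (simp add: word_Nil)
next
  case (Cons i "is")
  then have "raising_span m0 m1 n (length js - length is - 1)
      (\<lambda>\<alpha>. e (Low i) \<alpha> * (word (map (\<lambda>i. (Low i, \<alpha>)) is) * raising \<alpha> js))"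
    by (intro raising_span_lower) auto
  then show ?case
    by (simp add: single_Cons mult.assoc)
qed

section \<open>Eliminating the symbols \<open>\<beta>\<close>\<close>

text \<open>The letters are odd, and no second index equals a first index, so all brackets between
  them vanish.\<close>

definition anticommuting :: "(sym \<times> sym) set \<Rightarrow> bool" where
  "anticommuting X \<longleftrightarrow> (\<forall>s\<in>X. elem_parity s = 1 \<and> (\<forall>t\<in>X. snd s \<noteq> fst t))"

lemma anticommuting_swap:
  assumes "anticommuting X" "X \<subseteq> glb m0 m1 n" "s \<in> X" "t \<in> X" "z \<in> falg (glb m0 m1 n)"
  shows "irr_cong m0 m1 n (letter t * (letter s * z)) (- (letter s * (letter t * z)))"
proof -
  obtain a b c d where st: "s = (c, d)" "t = (a, b)" by (metis surj_pair)
  have "snd t \<noteq> fst s" "snd s \<noteq> fst t" "elem_parity t = 1" "elem_parity s = 1"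
    using assms(1,3,4) unfolding anticommuting_def by blast+
  moreover have "t \<in> glb m0 m1 n" "s \<in> glb m0 m1 n"
    using assms(2-4) by blast+
  ultimately show ?thesis
    using irr_cong_swap[OF _ _ assms(5) refl, of a b c d] unfolding st by simp
qed

lemma sign_left_commute: "(x :: 'a :: ring_1) * ((-1) ^ k * y) = (-1) ^ k * (x * y)"
  by (cases "even k") simp_all

lemma anticommuting_move:
  assumes "anticommuting X" "X \<subseteq> glb m0 m1 n" "set v \<subseteq> X" "s \<in> X" "z \<in> falg (glb m0 m1 n)"
  shows "irr_cong m0 m1 n (word v * (letter s * z)) ((-1) ^ length v * (letter s * (word v * z)))"
  using assms(3)
proof (induction v)
  case Nil
  show ?case by (simp add: word_Nil)
next
  case (Cons t v)
  then have t: "t \<in> X" "set v \<subseteq> X" by auto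
  have "irr_cong m0 m1 n (letter t * (word v * (letter s * z)))
      (letter t * ((-1) ^ length v * (letter s * (word v * z))))"
    using t assms(2) by (intro irr_cong_lmult falg_letter Cons.IH) auto
  \<comment> \<open>The factor 1 puts the sign into the form in which \<open>falg_sign\<close> shows
    that it lies in the algebra.\<close>
  also have "\<dots> = (-1) ^ length v * 1 * (letter t * (letter s * (word v * z)))"
    by (simp add: sign_left_commute)
  also have "irr_cong m0 m1 n \<dots> ((-1) ^ length v * 1 * (- (letter s * (letter t * (word v * z)))))"
    using t assms by (intro irr_cong_lmult anticommuting_swap[OF assms(1,2,4)] falg_sign falg_mult falg_word) auto
  finally show ?case
    by (simp add: single_Cons mult.assoc)
qed

text \<open>Moving the last letter to the front past \<open>length w\<close> others gives that many
  signs, and these numbers add up to the binomial coefficient.\<close>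

lemma word_rev_cong:
  assumes "anticommuting X" "X \<subseteq> glb m0 m1 n" "set w \<subseteq> X" "z \<in> falg (glb m0 m1 n)"
  shows "irr_cong m0 m1 n (word (rev w) * z) ((-1) ^ (length w choose 2) * (word w * z))"
  using assms(3,4)
proof (induction w arbitrary: z)
  case Nil
  show ?case by (simp add: word_Nil binomial_eq_0)
next
  case (Cons s w)
  then have s: "s \<in> X" "set w \<subseteq> X" "letter s \<in> falg (glb m0 m1 n)"
    using assms(2) by (auto intro!: falg_letter)
  let ?c = "(-1 :: (sym \<times> sym) free) ^ (length w choose 2)"
  have "word (rev (s # w)) * z = word (rev w) * (letter s * z)"
    by (simp add: word_append letter_def mult.assoc)
  also have "irr_cong m0 m1 n \<dots> (?c * (word w * (letter s * z)))"
    using s Cons.prems(2) by (intro Cons.IH falg_mult)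
  also have "\<dots> = ?c * 1 * (word w * (letter s * z))"
    by simp
  also have "irr_cong m0 m1 n \<dots> (?c * 1 * ((-1) ^ length w * (letter s * (word w * z))))"
    using s Cons.prems(2) assms by (intro irr_cong_lmult anticommuting_move[of X] falg_sign falg_1)
  also have "\<dots> = (-1) ^ (length (s # w) choose 2) * (word (s # w) * z)"
  proof -
    have "length (s # w) choose 2 = (length w choose 2) + length w"
      by (simp add: numeral_2_eq_2)
    then show ?thesis
      by (simp only: single_Cons mult.assoc power_add mult_1_left mult_1_right)
  qed
  finally show ?case .
qed

text \<open>The indices decrease from left to right, so that \<open>e \<alpha> (Beta m)\<close>
  placed in front meets its partner first.\<close>

definition beta_word :: "sym \<Rightarrow> nat \<Rightarrow> (sym \<times> sym) free" where
  "beta_word \<alpha> m = word (rev (map (\<lambda>i. (Beta i, \<alpha>)) [1..<m + 1]))"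

lemma beta_word_0 [simp]: "beta_word \<alpha> 0 = 1"
  by (simp add: beta_word_def word_Nil)

lemma beta_word_Suc [simp]: "beta_word \<alpha> (Suc m) = e (Beta (Suc m)) \<alpha> * beta_word \<alpha> m"
  by (simp add: beta_word_def single_Cons)

lemma Beta_virt: "i \<in> {1..m1} \<Longrightarrow> Beta i \<in> virt m0 m1"
  by (auto simp: virt_def A1_def)

lemma beta_word_falg: "\<alpha> \<in> virt m0 m1 \<Longrightarrow> m \<le> m1 \<Longrightarrow> beta_word \<alpha> m \<in> falg (glb m0 m1 n)"
  unfolding beta_word_def by (intro falg_word) (auto intro!: glb_virt Beta_virt)

context
  fixes m0 m1 n :: nat and \<alpha> :: sym and js :: "nat list"
  assumes \<alpha>: "\<alpha> \<in> A0 m0" and js: "set js \<subseteq> {1..n}"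
begin

private abbreviation cong (infix "\<approx>" 50) where "x \<approx> y \<equiv> irr_cong m0 m1 n x y"

private abbreviation "B m \<equiv> beta_word \<alpha> m * raising \<alpha> js"

private lemma v: "\<alpha> \<in> virt m0 m1"
  using \<alpha> by (rule A0_virt)

private lemma neq: "Beta i \<noteq> \<alpha>" "\<alpha> \<noteq> Beta i"
  using \<alpha> by (auto simp: A0_def)

private lemma parity: "elem_parity (\<alpha>, \<alpha>) = 0" "elem_parity (\<alpha>, Beta i) = 1"
    "elem_parity (Beta i, \<alpha>) = 1" "elem_parity (Beta i, Beta j) = 0"
  using \<alpha> by (auto simp: A0_def elem_parity_def)

private lemma B_falg: "m \<le> m1 \<Longrightarrow> B m \<in> falg (glb m0 m1 n)"
  using v js by (intro falg_mult beta_word_falg raising_falg)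

text \<open>As \<open>i\<close> exceeds all indices in the word, the letter commutes with its
  factors and is absorbed by \<open>virtual_raising\<close>.\<close>

lemma beta_beta_beta_word:
  "m \<le> m1 \<Longrightarrow> j \<in> {1..m1} \<Longrightarrow> i \<in> {1..m1} \<Longrightarrow> m < i \<Longrightarrow> e (Beta j) (Beta i) * B m \<approx> 0"
proof (induction m)
  case 0
  then show ?case
    using virtual_raising[OF v Beta_virt Beta_virt neq(1) js] by simp
next
  case (Suc m)
  have "Suc m \<in> {1..m1}" "m \<le> m1"
    using Suc.prems by auto
  note m = Beta_virt[OF this(1), of m0] this(2)
  have "e (Beta j) (Beta i) * B (Suc m) \<approx> e (Beta (Suc m)) \<alpha> * (e (Beta j) (Beta i) * B m)"
    using irr_cong_swap[OF glb_virt(1)[OF Beta_virt[OF Suc.prems(2)] Beta_virt[OF Suc.prems(3)]]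
        glb_virt(1)[OF m(1) v] B_falg[OF m(2)] refl] Suc.prems(4)
    by (simp add: parity neq mult.assoc)
  also have "\<dots> \<approx> e (Beta (Suc m)) \<alpha> * 0"
    using Suc.prems by (intro irr_cong_lmult Suc.IH falg_letter glb_virt m v) auto
  finally show ?case by simp
qed

text \<open>Each exchange leaves only \<open>e (Beta (Suc m)) (Beta i)\<close> as bracket, which the
  preceding lemma kills.\<close>

lemma alpha_beta_beta_word:
  "m \<le> m1 \<Longrightarrow> i \<in> {1..m1} \<Longrightarrow> m < i \<Longrightarrow> e \<alpha> (Beta i) * B m \<approx> 0"
proof (induction m)
  case 0
  then show ?case
    using virtual_raising[OF v v Beta_virt neq(1) js] by simp
next
  case (Suc m)
  have m': "Suc m \<in> {1..m1}" "m \<le> m1"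
    using Suc.prems by auto
  note m = Beta_virt[OF this(1), of m0] this(2)
  have "e \<alpha> (Beta i) * B (Suc m) \<approx>
      - (e (Beta (Suc m)) \<alpha> * (e \<alpha> (Beta i) * B m)) + e (Beta (Suc m)) (Beta i) * B m"
    using irr_cong_swap[OF glb_virt(1)[OF v Beta_virt[OF Suc.prems(2)]]
        glb_virt(1)[OF m(1) v] B_falg[OF m(2)] refl] Suc.prems(3)
    by (simp add: parity neq mult.assoc)
  also have "\<dots> \<approx> - (e (Beta (Suc m)) \<alpha> * 0) + 0"
    using Suc.prems m'
    by (intro irr_cong_add irr_cong_uminus irr_cong_lmult Suc.IH falg_letter glb_virt m v beta_beta_beta_word) auto
  finally show ?case by simp
qed

text \<open>Every \<open>e (Beta l) \<alpha>\<close> lowers the weight of \<alpha> by one. The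
  difference is taken in the complex numbers, since \<open>m\<close> may exceed
  \<open>length js\<close>.\<close>

lemma alpha_alpha_beta_word:
  "m \<le> m1 \<Longrightarrow> e \<alpha> \<alpha> * B m \<approx> free_const (of_nat (length js) - of_nat m) * B m"
proof (induction m)
  case 0
  show ?case
    using raising_weight[OF \<alpha> js] by (simp add: free_const_of_nat)
next
  case (Suc m)
  have m': "Suc m \<in> {1..m1}" "m \<le> m1"
    using Suc.prems by auto
  note m = Beta_virt[OF this(1), of m0] this(2)
  have "e \<alpha> \<alpha> * B (Suc m) \<approx> e (Beta (Suc m)) \<alpha> * (e \<alpha> \<alpha> * B m) + (- (e (Beta (Suc m)) \<alpha> * B m))"
    using irr_cong_swap[OF glb_virt(1)[OF v v] glb_virt(1)[OF m(1) v] B_falg[OF m(2)] refl]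
    by (simp add: parity neq mult.assoc)
  also have "\<dots> \<approx> e (Beta (Suc m)) \<alpha> * (free_const (of_nat (length js) - of_nat m) * B m)
      + (- (e (Beta (Suc m)) \<alpha> * B m))"
    by (intro irr_cong_add irr_cong_lmult Suc.IH falg_letter glb_virt m v irr_cong_refl)
  also have "\<dots> = free_const (of_nat (length js) - of_nat (Suc m)) * B (Suc m)"
  proof -
    have "free_const (of_nat (length js) - of_nat (Suc m)) =
        free_const (of_nat (length js) - of_nat m) - (1 :: (sym \<times> sym) free)"
      unfolding free_const_1[symmetric] free_const_def single_diff[symmetric] by (simp add: algebra_simps)
    then show ?thesis
      by (simp add: left_diff_distrib mult.assoc flip: free_const_left_commute)
  qed
  finally show ?case .
qed

text \<open>Of the three terms of the exchange only the one with \<open>e \<alpha> \<alpha>\<close>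
  survives.\<close>

lemma alpha_beta_beta_word_Suc:
  assumes "Suc m \<le> m1"
  shows "e \<alpha> (Beta (Suc m)) * B (Suc m) \<approx> free_const (of_nat (length js) - of_nat m) * B m"
proof -
  have m': "Suc m \<in> {1..m1}" "m \<le> m1" "m < Suc m"
    using assms by auto
  note m = Beta_virt[OF this(1), of m0] this(2)
  have "e \<alpha> (Beta (Suc m)) * B (Suc m) \<approx> - (e (Beta (Suc m)) \<alpha> * (e \<alpha> (Beta (Suc m)) * B m))
      + (e \<alpha> \<alpha> * B m + e (Beta (Suc m)) (Beta (Suc m)) * B m)"
    using irr_cong_swap[OF glb_virt(1)[OF v m(1)] glb_virt(1)[OF m(1) v] B_falg[OF m(2)] refl]
    by (simp add: parity neq mult.assoc)
  also have "\<dots> \<approx> - (e (Beta (Suc m)) \<alpha> * 0) + (free_const (of_nat (length js) - of_nat m) * B m + 0)"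
    by (intro irr_cong_add irr_cong_uminus irr_cong_lmult falg_letter glb_virt v m
        alpha_beta_beta_word alpha_alpha_beta_word beta_beta_beta_word m')
  finally show ?thesis by simp
qed

text \<open>Removing the innermost pair, the two letters with index \<open>Suc m\<close>, leaves the
  scalar \<open>length js - m\<close>; the scalars multiply to a falling factorial, which for
  \<open>m = length js\<close> is the factorial.\<close>

lemma alpha_word_beta_word:
  "m \<le> m1 \<Longrightarrow> word (map (\<lambda>i. (\<alpha>, Beta i)) [1..<m + 1]) * B m \<approx>
    free_const (\<Prod>i<m. of_nat (length js) - of_nat i) * raising \<alpha> js"
proof (induction m)
  case 0
  show ?case by (simp add: word_Nil)
next
  case (Suc m)
  let ?A = "word (map (\<lambda>i. (\<alpha>, Beta i)) [1..<m + 1])" and ?c = "of_nat (length js) - of_nat m"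
  have "word (map (\<lambda>i. (\<alpha>, Beta i)) [1..<Suc m + 1]) * B (Suc m) =
      ?A * (e \<alpha> (Beta (Suc m)) * B (Suc m))"
    by (simp add: word_append letter_def mult.assoc)
  also have "\<dots> \<approx> ?A * (free_const ?c * B m)"
    using Suc.prems v by (intro irr_cong_lmult falg_word alpha_beta_beta_word_Suc) (auto intro!: glb_virt Beta_virt)
  also have "\<dots> = free_const ?c * (?A * B m)"
    by (simp flip: free_const_left_commute)
  also have "\<dots> \<approx> free_const ?c * (free_const (\<Prod>i<m. of_nat (length js) - of_nat i) * raising \<alpha> js)"
    using Suc.prems by (intro irr_cong_lmult falg_free_const Suc.IH) auto
  finally show ?case
    by (simp add: free_const_mult_left mult.commute)
qed

end

section \<open>Comparison of the two central elements\<close>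

lemma Low_words_cong:
  assumes "\<alpha> \<in> A0 m0" "set js \<subseteq> {1..n}" "z \<in> falg (glb m0 m1 n)"
  shows "irr_cong m0 m1 n (word (map (\<lambda>i. (Low i, \<alpha>)) js) * z)
    ((-1) ^ (length js choose 2) * (word (map (\<lambda>i. (Low i, \<alpha>)) (rev js)) * z))"
proof -
  let ?w = "map (\<lambda>i. (Low i, \<alpha>)) (rev js)" and ?X = "(\<lambda>i. (Low i, \<alpha>)) ` {1..n}"
  have "anticommuting ?X"
    using assms(1) by (auto simp: anticommuting_def A0_def elem_parity_def)
  moreover have "?X \<subseteq> glb m0 m1 n"
    using assms(1) by (auto intro!: glb_virt A0_virt)
  moreover have "set ?w \<subseteq> ?X"
    using assms(2) by auto
  ultimately show ?thesis
    using word_rev_cong[of ?X m0 m1 n ?w z] assms(3) by (simp add: rev_map)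
qed

lemma beta_words_cong:
  assumes "\<alpha> \<in> A0 m0" "k \<le> m1" "z \<in> falg (glb m0 m1 n)"
  shows "irr_cong m0 m1 n (word (map (\<lambda>i. (Beta i, \<alpha>)) [1..<k + 1]) * z)
    ((-1) ^ (k choose 2) * (beta_word \<alpha> k * z))"
proof -
  let ?w = "rev (map (\<lambda>i. (Beta i, \<alpha>)) [1..<k + 1])" and ?X = "(\<lambda>i. (Beta i, \<alpha>)) ` {1..m1}"
  have "anticommuting ?X"
    using assms(1) by (auto simp: anticommuting_def A0_def elem_parity_def)
  moreover have "?X \<subseteq> glb m0 m1 n"
    using assms(1) by (auto intro!: glb_virt A0_virt Beta_virt)
  moreover have "set ?w \<subseteq> ?X"
    using assms(2) by auto
  ultimately show ?thesis
    using word_rev_cong[of ?X m0 m1 n ?w z] assms(3)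
    by (simp add: beta_word_def del: upt_Suc)
qed

lemma prod_diff_eq_fact: "(\<Prod>i<k. of_nat k - of_nat i :: complex) = of_nat (fact k)"
proof -
  have "of_nat (\<Prod>i<k. k - i) = (\<Prod>i<k. of_nat k - of_nat i :: complex)"
    unfolding of_nat_prod by (intro prod.cong) (auto simp: of_nat_diff)
  then show ?thesis
    using fact_prod_rev[of k, where 'a = nat] by (simp add: atLeast0LessThan)
qed

text \<open>Both words are reversed with the same sign, so the signs cancel and only the factorial
  remains.\<close>

lemma virtual_product_cong:
  assumes \<alpha>: "\<alpha> \<in> A0 m0" and k: "length js = k" "k \<le> m1" and js: "set js \<subseteq> {1..n}"
  shows "irr_cong m0 m1 n
    (word (map (\<lambda>i. (Low i, \<alpha>)) js) * (word (map (\<lambda>i. (\<alpha>, Beta i)) [1..<k + 1]) *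
      (word (map (\<lambda>i. (Beta i, \<alpha>)) [1..<k + 1]) * raising \<alpha> js)))
    (free_const (of_nat (fact k)) * (word (map (\<lambda>i. (Low i, \<alpha>)) (rev js)) * raising \<alpha> js))"
proof -
  have v: "\<alpha> \<in> virt m0 m1"
    using \<alpha> by (rule A0_virt)
  let ?W = "word (map (\<lambda>i. (Low i, \<alpha>)) js)" and ?W' = "word (map (\<lambda>i. (Low i, \<alpha>)) (rev js))"
  let ?A = "word (map (\<lambda>i. (\<alpha>, Beta i)) [1..<k + 1])" and ?M = "raising \<alpha> js"
  let ?s = "(-1 :: (sym \<times> sym) free) ^ (k choose 2)" and ?c = "free_const (of_nat (fact k))"
  have W: "?W \<in> falg (glb m0 m1 n)"
    using js v by (intro falg_word) (auto intro!: glb_virt)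
  have A: "?A \<in> falg (glb m0 m1 n)"
    using k v by (intro falg_word) (auto intro!: glb_virt Beta_virt)
  have M: "?M \<in> falg (glb m0 m1 n)"
    using v js by (rule raising_falg)
  have s: "?s \<in> falg (glb m0 m1 n)"
    using falg_sign[OF falg_1] by fastforce
  have "irr_cong m0 m1 n (?W * (?A * (word (map (\<lambda>i. (Beta i, \<alpha>)) [1..<k + 1]) * ?M)))
      (?W * (?A * (?s * (beta_word \<alpha> k * ?M))))"
    by (intro irr_cong_lmult W A beta_words_cong \<alpha> k M)
  also have "\<dots> = ?W * (?s * (?A * (beta_word \<alpha> k * ?M)))"
    by (simp only: sign_left_commute)
  also have "irr_cong m0 m1 n \<dots> (?W * (?s * (?c * ?M)))"
    using alpha_word_beta_word[OF \<alpha> js k(2)]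
    by (intro irr_cong_lmult W s) (simp only: k(1) prod_diff_eq_fact)
  also have "\<dots> = ?c * (?s * (?W * ?M))"
    by (simp only: sign_left_commute free_const_left_commute)
  also have "irr_cong m0 m1 n \<dots> (?c * (?s * (?s * (?W' * ?M))))"
    using Low_words_cong[OF \<alpha> js M] by (intro irr_cong_lmult s falg_free_const) (simp only: k(1))
  also have "\<dots> = ?c * (?W' * ?M)"
    by (simp flip: mult.assoc power_add)
  finally show ?thesis .
qed

text \<open>In a row the hook of a cell is the cell together with those to its right.\<close>

lemma hook_product_row: "hook_product [k] = fact k"
proof -
  have cells: "cells [k] = Pair 0 ` {..<k}"
    by (auto simp: cells_def)
  have "hook_length [k] (0, j) = k - j" if "j < k" for j
  proof -
    have "{(i', j'). (i', j') \<in> cells [k] \<and> (i' = 0 \<and> j \<le> j' \<or> 0 \<le> i' \<and> j' = j)} = Pair 0 ` {j..<k}"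
      using that by (auto simp: cells)
    then show ?thesis
      by (simp add: hook_length_def card_image inj_on_def)
  qed
  then have "hook_product [k] = (\<Prod>j<k. k - j)"
    unfolding hook_product_def cells by (subst prod.reindex) (auto simp: inj_on_def)
  then show ?thesis
    using fact_prod_rev[of k, where 'a = nat] by (simp add: atLeast0LessThan)
qed

lemma e_tab_eq_cls:
  assumes "set (zip (concat S) (concat T)) \<subseteq> glb m0 m1 n"
  shows "e_tab m0 m1 n S T = cls m0 m1 n (word (zip (concat S) (concat T)))"
  unfolding e_tab_def using assms by (rule e_prod_eq_cls)

lemma row_product_eq_cls:
  assumes "1 \<le> m0" "k \<le> m1" and r: "length r = k" "set r \<subseteq> {1..n}"
  defines "\<alpha> \<equiv> Alpha 1"
  shows "list_prod (U m0 m1 n)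
      [e_tab m0 m1 n (low_tableau [r]) (C_star [k]), e_tab m0 m1 n (C_star [k]) (D_star [k]),
       e_tab m0 m1 n (D_star [k]) (C_star [k]), e_tab m0 m1 n (C_star [k]) (low_tableau [r])]
    = cls m0 m1 n (word (map (\<lambda>i. (Low i, \<alpha>)) r) * (word (map (\<lambda>i. (\<alpha>, Beta i)) [1..<k + 1]) *
      (word (map (\<lambda>i. (Beta i, \<alpha>)) [1..<k + 1]) * raising \<alpha> r)))"
proof -
  have v: "\<alpha> \<in> virt m0 m1"
    using assms(1) by (auto simp: \<alpha>_def virt_def A0_def)
  have c: "concat (low_tableau [r]) = map Low r" "concat (C_star [k]) = replicate k \<alpha>"
    "concat (D_star [k]) = map Beta [1..<k + 1]"
    by (simp_all only: low_tableau_def C_star_def D_star_def \<alpha>_def) simp_all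
  have zips:
    "zip (concat (low_tableau [r])) (concat (C_star [k])) = map (\<lambda>i. (Low i, \<alpha>)) r"
    "zip (concat (C_star [k])) (concat (D_star [k])) = map (\<lambda>i. (\<alpha>, Beta i)) [1..<k + 1]"
    "zip (concat (D_star [k])) (concat (C_star [k])) = map (\<lambda>i. (Beta i, \<alpha>)) [1..<k + 1]"
    "zip (concat (C_star [k])) (concat (low_tableau [r])) = map (\<lambda>j. (\<alpha>, Low j)) r"
    unfolding c using r(1) by (simp_all add: zip_replicate1 zip_replicate2 comp_def del: upt_Suc)
  have sets: "set (map (\<lambda>i. (Low i, \<alpha>)) r) \<subseteq> glb m0 m1 n"
    "set (map (\<lambda>i. (\<alpha>, Beta i)) [1..<k + 1]) \<subseteq> glb m0 m1 n"
    "set (map (\<lambda>i. (Beta i, \<alpha>)) [1..<k + 1]) \<subseteq> glb m0 m1 n"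
    "set (map (\<lambda>j. (\<alpha>, Low j)) r) \<subseteq> glb m0 m1 n"
    using r(2) assms(2) v by (auto intro!: glb_virt Beta_virt)
  note f = sets[THEN falg_word]
  interpret U: ring "U m0 m1 n" by (rule ring_U)
  note tabs = e_tab_eq_cls[of "low_tableau [r]" "C_star [k]" m0 m1 n, unfolded zips, OF sets(1)]
    e_tab_eq_cls[of "C_star [k]" "D_star [k]" m0 m1 n, unfolded zips, OF sets(2)]
    e_tab_eq_cls[of "D_star [k]" "C_star [k]" m0 m1 n, unfolded zips, OF sets(3)]
    e_tab_eq_cls[of "C_star [k]" "low_tableau [r]" m0 m1 n, unfolded zips, OF sets(4)]
  show ?thesis
    by (simp only: list_prod_def foldr.simps o_apply id_apply tabs U.r_one cls_closed raising_def
        cls_mult falg_mult f)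
qed

lemma H_product_eq_cls:
  assumes "\<alpha> \<in> A0 m0" "set r \<subseteq> {1..n}"
  shows "e_prod m0 m1 n (map (\<lambda>i. (Low i, \<alpha>)) (rev r) @ map (\<lambda>i. (\<alpha>, Low i)) r) =
    cls m0 m1 n (word (map (\<lambda>i. (Low i, \<alpha>)) (rev r)) * raising \<alpha> r)"
proof -
  have "set (map (\<lambda>i. (Low i, \<alpha>)) (rev r) @ map (\<lambda>i. (\<alpha>, Low i)) r) \<subseteq> glb m0 m1 n"
    using assms by (auto intro!: glb_virt A0_virt)
  then show ?thesis
    by (simp only: e_prod_eq_cls word_append raising_def)
qed

text \<open>The same \<open>u\<close> evaluates both projections: the summand of
  \<open>H_central\<close> through \<alpha>, and the summand of \<open>S_central\<close> through
  \<open>Alpha 1\<close>, the only symbol in \<open>C_star [k]\<close>.\<close>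

lemma virt_proj_row_product:
  assumes m: "1 \<le> m0" "k \<le> m1" and \<alpha>: "\<alpha> \<in> A0 m0" and r: "length r = k" "set r \<subseteq> {1..n}"
  defines "h \<equiv> virt_proj m0 m1 n
    (e_prod m0 m1 n (map (\<lambda>i. (Low i, \<alpha>)) (rev r) @ map (\<lambda>i. (\<alpha>, Low i)) r))"
  shows "h \<in> carrier (U m0 m1 n)"
    and "virt_proj m0 m1 n (list_prod (U m0 m1 n)
      [e_tab m0 m1 n (low_tableau [r]) (C_star [k]), e_tab m0 m1 n (C_star [k]) (D_star [k]),
       e_tab m0 m1 n (D_star [k]) (C_star [k]), e_tab m0 m1 n (C_star [k]) (low_tableau [r])])
      = cls m0 m1 n (free_const (of_nat (fact k))) \<otimes>\<^bsub>U m0 m1 n\<^esub> h"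
proof -
  have \<alpha>1: "Alpha 1 \<in> A0 m0"
    using m(1) by (auto simp: A0_def)
  define P where "P \<alpha> = word (map (\<lambda>i. (Low i, \<alpha>)) (rev r)) * raising \<alpha> r" for \<alpha>
  define Q where "Q = word (map (\<lambda>i. (Low i, Alpha 1)) r) * (word (map (\<lambda>i. (Alpha 1, Beta i)) [1..<k + 1]) *
      (word (map (\<lambda>i. (Beta i, Alpha 1)) [1..<k + 1]) * raising (Alpha 1) r))"
  have P: "raising_span m0 m1 n 0 P"
    using raising_span_lowering[of "rev r" n r m0 m1] r(2) by (simp add: P_def[abs_def])
  obtain u where u: "u \<in> falg (L n \<times> L n)" "\<And>\<alpha>. \<alpha> \<in> A0 m0 \<Longrightarrow> irr_cong m0 m1 n (P \<alpha>) u"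
    using raising_span_0[OF P refl] by blast
  have ug: "u \<in> falg (glb m0 m1 n)"
    using u(1) falg_mono[OF Low_subset_glb] by blast
  have in_falg: "x \<in> falg (glb m0 m1 n)" if "irr_cong m0 m1 n x y" "y \<in> falg (glb m0 m1 n)" for x y
    using falg_add[OF irr_subset[OF that(1)[unfolded irr_cong_def]] that(2)] by simp
  have h: "h = cls m0 m1 n u"
    unfolding h_def H_product_eq_cls[OF \<alpha> r(2)]
    using in_falg[OF u(2)[OF \<alpha>] ug] u(1) u(2)[OF \<alpha>, unfolded irr_cong_def]
    unfolding P_def by (rule virt_proj_cls)
  then show "h \<in> carrier (U m0 m1 n)"
    using ug by (simp add: cls_closed)
  let ?c = "free_const (of_nat (fact k))"
  have "irr_cong m0 m1 n Q (?c * P (Alpha 1))"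
    unfolding Q_def P_def by (rule virtual_product_cong[OF \<alpha>1 r(1) m(2) r(2)])
  also have "irr_cong m0 m1 n \<dots> (?c * u)"
    by (intro irr_cong_lmult falg_free_const u(2) \<alpha>1)
  finally have Q: "irr_cong m0 m1 n Q (?c * u)" .
  have "virt_proj m0 m1 n (cls m0 m1 n Q) = cls m0 m1 n (?c * u)"
    using in_falg[OF Q falg_mult[OF falg_free_const ug]] falg_mult[OF falg_free_const u(1)]
      Q[unfolded irr_cong_def] by (rule virt_proj_cls)
  then show "virt_proj m0 m1 n (list_prod (U m0 m1 n)
      [e_tab m0 m1 n (low_tableau [r]) (C_star [k]), e_tab m0 m1 n (C_star [k]) (D_star [k]),
       e_tab m0 m1 n (D_star [k]) (C_star [k]), e_tab m0 m1 n (C_star [k]) (low_tableau [r])])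
      = cls m0 m1 n ?c \<otimes>\<^bsub>U m0 m1 n\<^esub> h"
    unfolding row_product_eq_cls[OF m r] h Q_def using ug by (simp add: cls_mult)
qed

lemma row_strict_tableaux_row:
  "row_strict_tableaux [k] n =
    (\<lambda>r. [r]) ` {r. length r = k \<and> sorted_wrt (<) r \<and> set r \<subseteq> {1..n}}"
  by (auto simp: row_strict_tableaux_def map_eq_Cons_conv)

theorem proposition4p53:
  fixes m0 m1 n k :: nat and \<alpha> :: sym
  assumes "1 \<le> n" and "1 \<le> k" and "k \<le> n"
    and "1 \<le> m0" and "k \<le> m1"
    and "\<alpha> \<in> A0 m0"
  shows "S_central m0 m1 n [k] = H_central m0 m1 n k \<alpha>"
proof -
  interpret U: ring "U m0 m1 n" by (rule ring_U)
  let ?R = "{r. length r = k \<and> sorted_wrt (<) r \<and> set r \<subseteq> {1..n}}"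
  let ?h = "\<lambda>r. virt_proj m0 m1 n
    (e_prod m0 m1 n (map (\<lambda>i. (Low i, \<alpha>)) (rev r) @ map (\<lambda>i. (\<alpha>, Low i)) r))"
  let ?s = "\<lambda>S. virt_proj m0 m1 n (list_prod (U m0 m1 n)
      [e_tab m0 m1 n (low_tableau S) (C_star [k]), e_tab m0 m1 n (C_star [k]) (D_star [k]),
       e_tab m0 m1 n (D_star [k]) (C_star [k]), e_tab m0 m1 n (C_star [k]) (low_tableau S)])"
  let ?c = "cls m0 m1 n (free_const (of_nat (fact k)))"
    and ?d = "cls m0 m1 n (free_const (1 / of_nat (fact k)))"
  have fin: "finite ?R"
    by (rule finite_subset[OF _ finite_lists_length_eq[of "{1..n}" k]]) auto
  have h: "?h r \<in> carrier (U m0 m1 n)" "?s [r] = ?c \<otimes>\<^bsub>U m0 m1 n\<^esub> ?h r" if "r \<in> ?R" for r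
  proof -
    have r: "length r = k" "set r \<subseteq> {1..n}"
      using that by blast+
    show "?h r \<in> carrier (U m0 m1 n)" "?s [r] = ?c \<otimes>\<^bsub>U m0 m1 n\<^esub> ?h r"
      by (rule virt_proj_row_product[OF assms(4-6) r])+
  qed
  have c: "?c \<in> carrier (U m0 m1 n)" "?d \<in> carrier (U m0 m1 n)"
    by (simp_all add: cls_closed)
  have H: "H_central m0 m1 n k \<alpha> = finsum (U m0 m1 n) ?h ?R"
    by (simp add: H_central_def)
  have s: "?s [r] \<in> carrier (U m0 m1 n)" if "r \<in> ?R" for r
    unfolding h(2)[OF that] by (intro U.m_closed c h that)
  have H_carrier: "H_central m0 m1 n k \<alpha> \<in> carrier (U m0 m1 n)"
    unfolding H by (intro U.finsum_closed Pi_I h)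
  \<comment> \<open>Tableaux with a single row correspond to the index lists over which
    \<open>H_central\<close> is summed.\<close>
  have "finsum (U m0 m1 n) ?s (row_strict_tableaux [k] n) = finsum (U m0 m1 n) (\<lambda>r. ?s [r]) ?R"
    unfolding row_strict_tableaux_row
  proof (rule U.finsum_reindex)
    show "?s \<in> (\<lambda>r. [r]) ` ?R \<rightarrow> carrier (U m0 m1 n)"
      by (rule Pi_I, erule imageE, hypsubst, rule s)
  qed (simp add: inj_on_def)
  also have "\<dots> = finsum (U m0 m1 n) (\<lambda>r. ?c \<otimes>\<^bsub>U m0 m1 n\<^esub> ?h r) ?R"
    by (intro U.finsum_cong' refl Pi_I U.m_closed c h)
  also have "\<dots> = ?c \<otimes>\<^bsub>U m0 m1 n\<^esub> H_central m0 m1 n k \<alpha>"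
    unfolding H by (intro U.finsum_rdistr[symmetric] fin c Pi_I h)
  finally have "S_central m0 m1 n [k] = ?d \<otimes>\<^bsub>U m0 m1 n\<^esub> (?c \<otimes>\<^bsub>U m0 m1 n\<^esub> H_central m0 m1 n k \<alpha>)"
    by (simp only: S_central_def env_scale_def hook_product_row)
  also have "\<dots> = (?d \<otimes>\<^bsub>U m0 m1 n\<^esub> ?c) \<otimes>\<^bsub>U m0 m1 n\<^esub> H_central m0 m1 n k \<alpha>"
    using c H_carrier by (simp add: U.m_assoc)
  also have "?d \<otimes>\<^bsub>U m0 m1 n\<^esub> ?c = \<one>\<^bsub>U m0 m1 n\<^esub>"
    by (simp add: free_const_mult cls_1 flip: cls_mult)
  finally show ?thesis
    using H_carrier by simp
qed

end
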